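(* Let $n\ge1$, $\alpha\in[0,n)$, and let $V$ be a finite positive measure on $\mathbb{R}^n$ that is absolutely continuous with respect to Lebesgue measure. Suppose $\Omega$ is a homogeneous function of degree zero on $\mathbb{R}^n\setminus\{0\}$ satisfying the $L^1_{\alpha}$-Dini condition. If the maximal operator $M^{\alpha}_{\Omega}$ is bounded from $L^1(\mathbb{R}^n)$ to $L^{\frac{n}{n-\alpha},\infty}(\mathbb{R}^n)$, then: (1) $\frac{\Omega(x)}{|x|^{n-\alpha}}\in L^{\frac{n}{n-\alpha},\infty}(\mathbb{R}^n)$ and $\big\|\frac{\Omega(\cdot)}{|\cdot|^{n-\alpha}}\big\|_{L^{\frac{n}{n-\alpha},\infty}}\le C\|M^{\alpha}_{\Omega}\|_{L^1\to L^{\frac{n}{n-\alpha},\infty}}$ for a constant $C$ depending only on $n,\alpha$; (2) $\Omega\in L^{\frac{n}{n-\alpha}}(\mathbb{S}^{n-1})$ and $\|\Omega\|_{L^{\frac{n}{n-\alpha}}(\mathbb{S}^{n-1})}\le C\|M^{\alpha}_{\Omega}\|_{L^1\to L^{\frac{n}{n-\alpha},\infty}}$ for a constant $C$ depending only on $n,\alpha$; (3) for every $\lambda>0$, $$\lim_{t\to0^+}\Big|\Big\{x\in\mathbb{R}^n:\Big|M^{\alpha}_{\Omega}(V_t)(x)-\frac{|\Omega(x)|}{|x|^{n-\alpha}}V(\mathbb{R}^n)\Big|>\lambda\Big\}\Big|=0.$$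
   Context: $\Omega$ homogeneous of degree zero means $\Omega(sx)=\Omega(x)$ for all $s>0$, $x\neq0$. For $1\le q<\infty$ and $0\le s<n$, $\Omega$ satisfies the $L^q_s$-Dini condition if $\Omega\in L^q(\mathbb{S}^{n-1})$ and $\int_0^1\frac{\omega_q(t)}{t^{1+s}}dt<\infty$, where $\omega_q(t)=\big(\sup_{|h|\le t}\int_{\mathbb{S}^{n-1}}|\Omega(x'+h)-\Omega(x')|^q\,d\sigma(x')\big)^{1/q}$ and $\sigma$ is surface measure on the unit sphere. For a positive measure $\mu$, $M^{\alpha}_{\Omega}\mu(x)=\sup_{r>0}\frac{1}{r^{n-\alpha}}\int_{B(x,r)}|\Omega(x-y)|\,d\mu(y)$; for a function $f$ it acts via $d\mu=|f(y)|dy$. For $t>0$, $V_t(E)=V(E/t)$ with $E/t=\{x/t:x\in E\}$. $L^{p,\infty}$ is weak $L^p$ with quasinorm $\sup_{\lambda>0}\lambda|\{|f|>\lambda\}|^{1/p}$. *)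

theory Defs
  imports "HOL-Analysis.Analysis"
begin

definition homogeneous0 :: "(real^'n \<Rightarrow> real) \<Rightarrow> bool" where
  "homogeneous0 \<Omega> \<longleftrightarrow> (\<forall>s>0. \<forall>x. x \<noteq> 0 \<longrightarrow> \<Omega> (s *\<^sub>R x) = \<Omega> x)"

text \<open>Surface measure on the unit sphere S^{n-1} (completed), via polar coordinates:
  sigma(A) = n * |{r x : 0 < r < 1, x in A}|.\<close>
definition sphere_measure :: "(real^'n) measure" where
  "sphere_measure = completion
     (distr (density (restrict_space lborel (ball 0 1 - {0})) (\<lambda>_. ennreal (real CARD('n))))
            (restrict_space borel (sphere 0 1)) (\<lambda>x. x /\<^sub>R norm x))"

definition sphere_Lp :: "real \<Rightarrow> (real^'n \<Rightarrow> real) \<Rightarrow> bool" where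
  "sphere_Lp q \<Omega> \<longleftrightarrow> \<Omega> \<in> borel_measurable sphere_measure \<and>
     (\<integral>\<^sup>+ x. ennreal (\<bar>\<Omega> x\<bar> powr q) \<partial>sphere_measure) < \<infinity>"

definition sphere_Lp_norm :: "real \<Rightarrow> (real^'n \<Rightarrow> real) \<Rightarrow> real" where
  "sphere_Lp_norm q \<Omega> = (enn2real (\<integral>\<^sup>+ x. ennreal (\<bar>\<Omega> x\<bar> powr q) \<partial>sphere_measure)) powr (1 / q)"

definition ennroot :: "real \<Rightarrow> ennreal \<Rightarrow> ennreal" where
  "ennroot q a = (if a = \<infinity> then \<infinity> else ennreal (enn2real a powr (1 / q)))"

definition modulus :: "real \<Rightarrow> (real^'n \<Rightarrow> real) \<Rightarrow> real \<Rightarrow> ennreal" where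
  "modulus q \<Omega> t = ennroot q (SUP h \<in> cball 0 t.
      (\<integral>\<^sup>+ x. ennreal (\<bar>\<Omega> (x + h) - \<Omega> x\<bar> powr q) \<partial>sphere_measure))"

definition Dini :: "real \<Rightarrow> real \<Rightarrow> (real^'n \<Rightarrow> real) \<Rightarrow> bool" where
  "Dini q s \<Omega> \<longleftrightarrow> sphere_Lp q \<Omega> \<and>
     (\<integral>\<^sup>+ t \<in> {0<..1}. modulus q \<Omega> t / ennreal (t powr (1 + s)) \<partial>lborel) < \<infinity>"

definition leb_outer :: "(real^'n) set \<Rightarrow> ennreal" where
  "leb_outer S = (INF A \<in> {A \<in> sets lebesgue. S \<subseteq> A}. emeasure lebesgue A)"

definition maxop :: "real \<Rightarrow> (real^'n \<Rightarrow> real) \<Rightarrow> (real^'n) measure \<Rightarrow> real^'n \<Rightarrow> ennreal" where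
  "maxop \<alpha> \<Omega> \<mu> x = (SUP r \<in> {0<..}.
     ennreal (1 / r powr (real CARD('n) - \<alpha>)) *
     (\<integral>\<^sup>+ y \<in> ball x r. ennreal \<bar>\<Omega> (x - y)\<bar> \<partial>\<mu>))"

definition maxop_fun :: "real \<Rightarrow> (real^'n \<Rightarrow> real) \<Rightarrow> (real^'n \<Rightarrow> real) \<Rightarrow> real^'n \<Rightarrow> ennreal" where
  "maxop_fun \<alpha> \<Omega> f = maxop \<alpha> \<Omega> (density lebesgue (\<lambda>y. ennreal \<bar>f y\<bar>))"

definition weak_norm :: "real \<Rightarrow> (real^'n \<Rightarrow> ennreal) \<Rightarrow> ennreal" where
  "weak_norm p g = (SUP l \<in> {0<..}. ennreal l * ennroot p (leb_outer {x. ennreal l < g x}))"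

definition weak_Lp :: "real \<Rightarrow> (real^'n \<Rightarrow> real) \<Rightarrow> bool" where
  "weak_Lp p g \<longleftrightarrow> g \<in> borel_measurable lebesgue \<and> weak_norm p (\<lambda>x. ennreal \<bar>g x\<bar>) < \<infinity>"

definition maxop_norm :: "real \<Rightarrow> (real^'n \<Rightarrow> real) \<Rightarrow> ennreal" where
  "maxop_norm \<alpha> \<Omega> = (SUP f \<in> {f. f \<in> borel_measurable lebesgue \<and>
        0 < (\<integral>\<^sup>+ y. ennreal \<bar>f y\<bar> \<partial>lebesgue) \<and> (\<integral>\<^sup>+ y. ennreal \<bar>f y\<bar> \<partial>lebesgue) < \<infinity>}.
     weak_norm (real CARD('n) / (real CARD('n) - \<alpha>)) (maxop_fun \<alpha> \<Omega> f)
       / (\<integral>\<^sup>+ y. ennreal \<bar>f y\<bar> \<partial>lebesgue))"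

end

theory Submission
  imports Defs
begin

text \<open>
  Both the lower bound for the norm of the maximal operator and the concentration statement
  compare \<open>maxop \<alpha> \<Omega> W\<close>, for a measure \<open>W\<close> living on a ball of small radius \<open>\<delta>\<close> about the origin,
  with \<open>W(\<real>\<^sup>n) |\<Omega>(x)| / |x|\<^sup>a\<close>, where \<open>a = n - \<alpha>\<close>. For \<open>|x| \<ge> \<rho> \<ge> 2\<delta>\<close> the only relevant radii are within \<open>2\<delta>\<close>
  of \<open>|x|\<close>, so up to a factor \<open>(1 + 2\<delta>/\<rho>)\<^sup>a\<close> the error is
  \<open>|x|\<^sup>-\<^sup>a \<integral> |\<Omega>(x - y) - \<Omega>(x)| dW(y)\<close>. By Fubini and polar coordinates its \<open>L\<^sup>1\<close> norm over \<open>|x| \<ge> \<rho>\<close>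
  is at most \<open>W(\<real>\<^sup>n)\<close> times \<open>\<delta>\<^sup>\<alpha> \<integral> \<omega>(v) v\<^sup>-\<^sup>1\<^sup>-\<^sup>\<alpha> dv\<close> over \<open>0 < v \<le> \<delta>/\<rho>\<close>, a tail of the Dini integral, which vanishes as \<open>\<delta> \<rightarrow> 0\<close>;
  Chebyshev's inequality turns this into convergence in measure. For the weak type bound take
  \<open>W\<close> uniform on the ball. For concentration, cut \<open>V\<^sub>t\<close> into its part on the ball of radius \<open>tR\<close> and a
  remainder of small mass, which is controlled by the weak type bound for the maximal operator.
  The \<open>L\<^sup>p\<close> bound on the sphere follows because
  \<open>n |{|\<Omega>(x)| > |x|\<^sup>a}|\<close> is exactly \<open>\<integral> |\<Omega>|\<^sup>p d\<sigma>\<close> for \<open>p = n / a\<close>.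
\<close>

section \<open>Polar coordinates with inverse radius\<close>

text \<open>
  The sphere measure before completion: \<open>x \<mapsto> x/|x|\<close> is measurable from \<open>lborel\<close> only to the uncompleted
  \<open>\<sigma>\<close>-algebra.
\<close>

definition sphere_measure0 :: "(real^'n) measure" where
  "sphere_measure0 = distr (density (restrict_space lborel (ball 0 1 - {0})) (\<lambda>_. ennreal (real CARD('n))))
            (restrict_space borel (sphere 0 1)) (\<lambda>x. x /\<^sub>R norm x)"

lemma sphere_measure_eq: "sphere_measure = completion sphere_measure0"
  by (simp add: sphere_measure_def sphere_measure0_def)

lemma sets_sphere_measure0[measurable_cong]: "sets sphere_measure0 = sets (restrict_space borel (sphere 0 1))"
  by (simp add: sphere_measure0_def)

lemma space_sphere_measure0: "space sphere_measure0 = sphere 0 1"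
  by (simp add: sphere_measure0_def space_restrict_space)

lemma measurable_radial_projection:
  assumes "A \<in> sets borel" "0 \<notin> A"
  shows "(\<lambda>x::'a::euclidean_space. x /\<^sub>R norm x) \<in> restrict_space borel A \<rightarrow>\<^sub>M restrict_space borel (sphere 0 1)"
proof (rule measurable_restrict_space2)
  show "(\<lambda>x::'a. x /\<^sub>R norm x) \<in> space (restrict_space borel A) \<rightarrow> sphere 0 1"
    using assms by (auto simp: space_restrict_space intro!: left_inverse)
  show "(\<lambda>x::'a. x /\<^sub>R norm x) \<in> borel_measurable (restrict_space borel A)"
    by (rule measurable_restrict_space1) simp
qed

lemma sets_borel_cone:
  assumes B: "B \<in> sets (restrict_space borel (sphere 0 1))"
  shows "{x::'a::euclidean_space. x \<noteq> 0 \<and> x /\<^sub>R norm x \<in> B} \<in> sets borel"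
proof -
  have "B \<in> sets borel" using B by (auto simp: sets_restrict_space)
  moreover have "(\<lambda>x::'a. x /\<^sub>R norm x) \<in> borel_measurable borel" by simp
  ultimately have "(\<lambda>x::'a. x /\<^sub>R norm x) -` B \<in> sets borel"
    using measurable_sets[of "(\<lambda>x::'a. x /\<^sub>R norm x)" borel borel B] by simp
  moreover have "{x::'a. x \<noteq> 0 \<and> x /\<^sub>R norm x \<in> B} = (\<lambda>x::'a. x /\<^sub>R norm x) -` B - {0}" by auto
  ultimately show ?thesis by auto
qed

lemma emeasure_sphere_measure0:
  assumes B: "B \<in> sets (restrict_space borel (sphere 0 1))"
  shows "emeasure (sphere_measure0::(real^'n) measure) B =
    ennreal (real CARD('n)) * emeasure lborel {x. 0 < norm x \<and> norm x < 1 \<and> x /\<^sub>R norm x \<in> B}"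
proof -
  let ?S = "ball 0 1 - {0::real^'n}"
  let ?f = "\<lambda>x::real^'n. x /\<^sub>R norm x"
  let ?A = "{x::real^'n. 0 < norm x \<and> norm x < 1 \<and> x /\<^sub>R norm x \<in> B}"
  have fm: "?f \<in> restrict_space lborel ?S \<rightarrow>\<^sub>M restrict_space borel (sphere 0 1)"
    using measurable_radial_projection[of ?S]
    by (auto cong: measurable_cong_sets simp: measurable_def sets_restrict_space space_restrict_space)
  have A: "?f -` B \<inter> space (restrict_space lborel ?S) = ?A"
    by (auto simp: space_restrict_space)
  have As: "?A \<in> sets (restrict_space lborel ?S)"
    using measurable_sets[OF fm B] A by simp
  have "emeasure (sphere_measure0::(real^'n) measure) B
     = emeasure (density (restrict_space lborel ?S) (\<lambda>_. ennreal (real CARD('n)))) ?A"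
    unfolding sphere_measure0_def using B fm A by (subst emeasure_distr) auto
  also have "\<dots> = ennreal (real CARD('n)) * emeasure (restrict_space lborel ?S) ?A"
    using As by (subst emeasure_density) (auto simp: nn_integral_cmult)
  also have "emeasure (restrict_space lborel ?S) ?A = emeasure lborel ?A"
    by (rule emeasure_restrict_space) (auto)
  finally show ?thesis .
qed

lemma finite_sphere_measure0: "finite_measure (sphere_measure0::(real^'n) measure)"
proof
  let ?B = "sphere (0::real^'n) 1"
  have "?B \<in> sets (restrict_space borel (sphere 0 1))"
    by (metis sets.top space_restrict_space space_borel inf_top.left_neutral inf_top.right_neutral)
  then have "emeasure (sphere_measure0::(real^'n) measure) ?B =
    ennreal (real CARD('n)) * emeasure lborel {x. 0 < norm x \<and> norm x < 1 \<and> x /\<^sub>R norm x \<in> ?B}"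
    by (rule emeasure_sphere_measure0)
  also have "\<dots> \<le> ennreal (real CARD('n)) * emeasure lborel (ball (0::real^'n) 1)"
    by (intro mult_left_mono emeasure_mono) auto
  also have "\<dots> < \<infinity>"
    by (metis emeasure_lborel_ball_finite ennreal_mult_less_top infinity_ennreal_def ennreal_less_top)
  finally show "emeasure (sphere_measure0::(real^'n) measure) (space sphere_measure0) \<noteq> \<infinity>"
    by (simp add: space_sphere_measure0)
qed

text \<open>The set is the dilate by 1/u of the truncated unit cone behind
  \<open>sphere_measure0\<close>, so Lebesgue measure scales by \<open>u^(-n)\<close>; the weight n
  built into the surface measure produces the 1/n.\<close>

lemma emeasure_truncated_cone:
  assumes B: "B \<in> sets (restrict_space borel (sphere 0 1))" and u: "u > 0"
  shows "emeasure lborel {x::real^'n. x \<noteq> 0 \<and> u < 1 / norm x \<and> x /\<^sub>R norm x \<in> B} =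
    ennreal (1 / (real CARD('n) * u ^ CARD('n))) * emeasure sphere_measure0 B"
proof -
  let ?A = "{x::real^'n. 0 < norm x \<and> norm x < 1 \<and> x /\<^sub>R norm x \<in> B}"
  let ?C = "{x::real^'n. x \<noteq> 0 \<and> u < 1 / norm x \<and> x /\<^sub>R norm x \<in> B}"
  have "?A = {x. x \<noteq> 0 \<and> x /\<^sub>R norm x \<in> B} \<inter> ball 0 1" by auto
  then have As: "?A \<in> sets borel" using sets_borel_cone[OF B] by auto
  have "?C = {x. x \<noteq> 0 \<and> x /\<^sub>R norm x \<in> B} \<inter> ball 0 (1/u)"
    using u by (auto simp: field_simps)
  then have Cs: "?C \<in> sets borel" using sets_borel_cone[OF B] by auto
  have C: "?C = (\<lambda>x. (1/u) *\<^sub>R x + 0) ` ?A"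
  proof (intro set_eqI iffI)
    fix x assume "x \<in> ?C"
    then have "u *\<^sub>R x \<in> ?A" "x = (1/u) *\<^sub>R (u *\<^sub>R x) + 0" using u by (auto simp: field_simps)
    then show "x \<in> (\<lambda>x. (1/u) *\<^sub>R x + 0) ` ?A" by (rule rev_image_eqI)
  next
    fix x assume "x \<in> (\<lambda>x. (1/u) *\<^sub>R x + 0) ` ?A"
    then show "x \<in> ?C" using u by (auto simp: field_simps)
  qed
  have "emeasure lborel ?C = emeasure lebesgue ?C" using Cs by simp
  also have "\<dots> = ennreal (\<bar>1/u\<bar> ^ DIM(real^'n)) * emeasure lebesgue ?A"
    unfolding C by (rule emeasure_lebesgue_affine)
  also have "emeasure lebesgue ?A = emeasure lborel ?A" using As by simp
  finally have 1: "emeasure lborel ?C = ennreal ((1/u) ^ CARD('n)) * emeasure lborel ?A"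
    using u by simp
  have "ennreal (1 / (real CARD('n) * u ^ CARD('n))) * emeasure sphere_measure0 B
     = (ennreal (1 / (real CARD('n) * u ^ CARD('n))) * ennreal (real CARD('n))) * emeasure lborel ?A"
    unfolding emeasure_sphere_measure0[OF B] by (simp add: mult.assoc)
  also have "ennreal (1 / (real CARD('n) * u ^ CARD('n))) * ennreal (real CARD('n)) = ennreal ((1/u) ^ CARD('n))"
    using u by (simp add: ennreal_mult[symmetric] power_divide)
  finally show ?thesis using 1 by simp
qed

text \<open>
  The law of \<open>u = 1/|x|\<close> under polar coordinates. With the inverse radius, a translation of \<open>\<theta>/u\<close> by \<open>y\<close>
  becomes a translation of \<open>\<theta>\<close> by \<open>u y\<close>, so that the Dini integral appears without a nonlinear substitution.
\<close>

definition inv_radial :: "nat \<Rightarrow> real measure" where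
  "inv_radial n = density lborel (\<lambda>u. ennreal (indicator {0<..} u * (1 / u ^ Suc n)))"

lemma sets_inv_radial[simp, measurable_cong]: "sets (inv_radial n) = sets borel"
  by (simp add: inv_radial_def)

text \<open>Fundamental theorem of calculus with antiderivative -1/(n u^n), which vanishes at
  infinity. The value is the radial factor in \<open>emeasure_truncated_cone\<close>, and this match
  identifies the law of 1/|x|.\<close>

lemma emeasure_inv_radial_Ioi:
  assumes u: "u > 0" and n: "n > 0"
  shows "emeasure (inv_radial n) {u<..} = ennreal (1 / (real n * u ^ n))"
proof -
  let ?f = "\<lambda>u::real. indicator {0<..} u * (1 / u ^ Suc n)"
  let ?F = "\<lambda>u::real. - (1 / (real n * u ^ n))"
  have "emeasure (inv_radial n) {u<..} = (\<integral>\<^sup>+x. ennreal (?f x) * indicator {u<..} x \<partial>lborel)"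
    unfolding inv_radial_def by (rule emeasure_density) auto
  \<comment> \<open>The integration rule is stated for closed half-lines; the added endpoint is a
    null set.\<close>
  also have "\<dots> = (\<integral>\<^sup>+x. ennreal (?f x) * indicator {u..} x \<partial>lborel)"
  proof (rule nn_integral_cong_AE)
    show "AE x in lborel. ennreal (?f x) * indicator {u<..} x = ennreal (?f x) * indicator {u..} x"
      using AE_lborel_singleton[of u] by eventually_elim (auto split: split_indicator)
  qed
  also have "\<dots> = ennreal (0 - ?F u)"
  proof (rule nn_integral_FTC_atLeast)
    show "?f \<in> borel_measurable borel" by measurable
    fix x assume "u \<le> x"
    then have x: "x > 0" using u by simp
    show "0 \<le> ?f x" using x by simp
    have "(?F has_real_derivative (real n * (real n * x ^ (n - 1))) / (real n * x ^ n)^2) (at x)"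
      using x n by (auto intro!: derivative_eq_intros simp: power2_eq_square)
    moreover have "(real n * (real n * x ^ (n - 1))) / (real n * x ^ n)^2 = ?f x"
    proof -
      obtain m where m: "n = Suc m" using n by (cases n) auto
      have "(N * (N * X)) / (N * (x * X))^2 = 1 / (x * (x * X))" if "N > 0" "X > 0" for N X :: real
        using that x by (simp add: power2_eq_square)
      from this[of "real n" "x ^ m"] show ?thesis using x m by simp
    qed
    ultimately show "(?F has_real_derivative ?f x) (at x)" by simp
  next
    have "filterlim (\<lambda>u::real. real n * u ^ n) at_top at_top"
      using n by (intro filterlim_tendsto_pos_mult_at_top[OF tendsto_const] filterlim_pow_at_top filterlim_ident) auto
    then have "((\<lambda>u::real. 1 / (real n * u ^ n)) \<longlongrightarrow> 0) at_top"
      by (intro tendsto_divide_0[OF tendsto_const] filterlim_at_top_imp_at_infinity)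
    then show "(?F \<longlongrightarrow> 0) at_top" using tendsto_minus by fastforce
  qed
  finally show ?thesis by simp
qed

text \<open>Mass may be infinite near 0, as it is for \<open>inv_radial\<close>, so uniqueness from
  half-lines is applied to the restrictions to (1/(k+1), \<infinity>). These exhaust the positive
  axis, and the rest of the line is null by hypothesis.\<close>

lemma measure_eqI_Ioi_pos:
  fixes M N :: "real measure"
  assumes sets: "sets M = sets borel" "sets N = sets borel"
    and neg: "emeasure M {..0} = 0" "emeasure N {..0} = 0"
    and fin: "\<And>x. x > 0 \<Longrightarrow> emeasure M {x<..} < \<infinity>"
    and eq: "\<And>x. x > 0 \<Longrightarrow> emeasure M {x<..} = emeasure N {x<..}"
  shows "M = N"
proof (rule measure_eqI)
  show "sets M = sets N" using sets by simp
  fix A assume "A \<in> sets M"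
  then have A: "A \<in> sets borel" using sets by simp
  let ?c = "\<lambda>k::nat. 1 / real (Suc k)"
  have restr: "density M (indicator {?c k<..}) = density N (indicator {?c k<..})" for k
  proof (rule measure_eqI_lessThan)
    have *: "emeasure (density L (indicator {?c k<..})) {x<..} = emeasure L {max x (?c k)<..}"
      if "sets L = sets borel" for x and L :: "real measure"
    proof -
      have [measurable_cong]: "sets L = sets borel" by fact
      have i: "{max x (?c k)<..} = {?c k<..} \<inter> {x<..}" by auto
      show ?thesis unfolding i
        by (subst emeasure_density)
          (auto simp: nn_integral_indicator[symmetric] that simp del: nn_integral_indicator intro!: nn_integral_cong split: split_indicator)
    qed
    fix x :: real
    have p: "max x (?c k) > 0" by (simp add: less_max_iff_disj)
    show "emeasure (density M (indicator {?c k<..})) {x<..} < \<infinity>" using fin[OF p] *[of M] sets by simp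
    show "emeasure (density M (indicator {?c k<..})) {x<..} = emeasure (density N (indicator {?c k<..})) {x<..}"
      using eq[OF p] * sets by simp
  qed (use sets in auto)
  have key: "emeasure L A = (SUP k. emeasure (density L (indicator {?c k<..})) A)"
    if L: "sets L = sets borel" "emeasure L {..0} = 0" for L :: "real measure"
  proof -
    have AL: "A \<in> sets L" using L A by simp
    have "{..0} \<in> null_sets L" using L by auto
    then have "emeasure L A = emeasure L (A - {..0})" using AL by (simp add: emeasure_Diff_null_set)
    also have "A - {..0} = (\<Union>k. A \<inter> {?c k<..})"
    proof (intro set_eqI iffI)
      fix x assume "x \<in> A - {..0}"
      then have "x \<in> A" "x > 0" by auto
      then obtain k where "?c k < x" using nat_approx_posE by (metis of_nat_Suc)
      then show "x \<in> (\<Union>k. A \<inter> {?c k<..})" using \<open>x\<in>A\<close> by auto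
    next
      fix x assume "x \<in> (\<Union>k. A \<inter> {?c k<..})"
      then obtain k where "x \<in> A" "?c k < x" by auto
      moreover have "0 < ?c k" by simp
      ultimately show "x \<in> A - {..0}" using less_trans[of 0 "?c k" x] by (simp add: not_le)
    qed
    also have "emeasure L (\<Union>k. A \<inter> {?c k<..}) = (SUP k. emeasure L (A \<inter> {?c k<..}))"
    proof (rule SUP_emeasure_incseq[symmetric])
      show "range (\<lambda>k. A \<inter> {?c k<..}) \<subseteq> sets L"
      proof (intro image_subsetI)
        fix k
        have "{?c k<..} \<in> sets L" using L(1) by simp
        then show "A \<inter> {?c k<..} \<in> sets L" by (rule sets.Int[OF AL])
      qed
      show "incseq (\<lambda>k. A \<inter> {?c k<..})"
      proof (rule monoI)
        fix i j :: nat assume "i \<le> j"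
        then have "?c j \<le> ?c i" by (simp add: frac_le)
        then show "A \<inter> {?c i<..} \<subseteq> A \<inter> {?c j<..}" by auto
      qed
    qed
    also have "\<dots> = (SUP k. emeasure (density L (indicator {?c k<..})) A)"
    proof (rule SUP_cong[OF refl])
      fix k
      show "emeasure L (A \<inter> {?c k<..}) = emeasure (density L (indicator {?c k<..})) A"
        using AL L by (subst emeasure_density)
         (auto simp: nn_integral_indicator[symmetric] simp del: nn_integral_indicator intro!: nn_integral_cong split: split_indicator)
    qed
    finally show ?thesis .
  qed
  show "emeasure M A = emeasure N A"
    using key[OF sets(1) neg(1)] key[OF sets(2) neg(2)] restr by simp
qed

lemma measurable_inv_polar:
  "(\<lambda>x::'a::euclidean_space. (1 / norm x, x /\<^sub>R norm x)) \<in>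
    restrict_space lborel (-{0}) \<rightarrow>\<^sub>M borel \<Otimes>\<^sub>M restrict_space borel (sphere 0 1)"
proof (rule measurable_Pair)
  have eq: "sets (restrict_space lborel (-{0::'a})) = sets (restrict_space borel (-{0}))"
    by (simp add: sets_restrict_space)
  show "(\<lambda>x::'a. 1 / norm x) \<in> borel_measurable (restrict_space lborel (- {0}))"
    by (rule measurable_restrict_space1) simp
  show "(\<lambda>x::'a. x /\<^sub>R norm x) \<in> restrict_space lborel (- {0}) \<rightarrow>\<^sub>M restrict_space borel (sphere 0 1)"
    unfolding measurable_cong_sets[OF eq refl] by (rule measurable_radial_projection) auto
qed

lemma sigma_finite_inv_radial: "sigma_finite_measure (inv_radial n)"
  unfolding inv_radial_def
proof (subst sigma_finite_measure.sigma_finite_iff_density_finite'[OF sigma_finite_lborel])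
  show "(\<lambda>u. ennreal (indicator {0<..} u * (1 / u ^ Suc n))) \<in> borel_measurable lborel" by simp
qed auto

text \<open>A product measure is determined by rectangles. With the angular set \<open>B\<close>
  fixed, both sides are measures in the radial set \<open>A\<close>, and they agree on half-lines by
  \<open>emeasure_truncated_cone\<close>.\<close>

lemma distr_inv_polar:
  "inv_radial CARD('n) \<Otimes>\<^sub>M sphere_measure0 =
    distr (restrict_space lborel (-{0::real^'n})) (borel \<Otimes>\<^sub>M restrict_space borel (sphere 0 1))
      (\<lambda>x. (1 / norm x, x /\<^sub>R norm x))"
proof (rule pair_measure_eqI)
  interpret finite_measure "sphere_measure0 :: (real^'n) measure" by (rule finite_sphere_measure0)
  let ?R = "restrict_space lborel (-{0::real^'n})"
  show "sigma_finite_measure (inv_radial CARD('n))" by (rule sigma_finite_inv_radial)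
  show "sigma_finite_measure (sphere_measure0 :: (real^'n) measure)" ..
  show "sets (inv_radial CARD('n) \<Otimes>\<^sub>M (sphere_measure0 :: (real^'n) measure)) =
    sets (distr ?R (borel \<Otimes>\<^sub>M restrict_space borel (sphere 0 1)) (\<lambda>x. (1 / norm x, x /\<^sub>R norm x)))"
    unfolding sets_distr by (intro sets_pair_measure_cong sets_inv_radial sets_sphere_measure0)
  fix A :: "real set" and B :: "(real^'n) set"
  assume "A \<in> sets (inv_radial CARD('n))" and "B \<in> sets sphere_measure0"
  then have A: "A \<in> sets borel" and B: "B \<in> sets (restrict_space borel (sphere 0 1))"
    by (simp_all add: sets_sphere_measure0)
  let ?K = "{x::real^'n. x \<noteq> 0 \<and> x /\<^sub>R norm x \<in> B}"
  have K: "?K \<in> sets borel" by (rule sets_borel_cone[OF B])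
  \<comment> \<open>\<open>L\<close> is the law of 1/|x| under Lebesgue measure on the cone over
    \<open>B\<close>; \<open>N\<close> below is the product side with the same \<open>B\<close>,
    namely \<open>inv_radial\<close> scaled by the surface measure of \<open>B\<close>.\<close>
  define L where "L = distr (density lborel (indicator ?K)) borel (\<lambda>x::real^'n. 1 / norm x)"
  have emL: "emeasure L S = emeasure lborel {x::real^'n. x \<noteq> 0 \<and> 1 / norm x \<in> S \<and> x /\<^sub>R norm x \<in> B}"
    if S: "S \<in> sets borel" for S
  proof -
    have V: "(\<lambda>x::real^'n. 1 / norm x) -` S \<in> sets borel"
      using measurable_sets[of "\<lambda>x::real^'n. 1 / norm x" borel borel S] S by simp
    have "emeasure L S = emeasure (density lborel (indicator ?K)) ((\<lambda>x::real^'n. 1 / norm x) -` S)"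
      unfolding L_def using S by (subst emeasure_distr) auto
    also have "\<dots> = (\<integral>\<^sup>+x. indicator ?K x * indicator ((\<lambda>x::real^'n. 1 / norm x) -` S) x \<partial>lborel)"
      using V K by (subst emeasure_density) auto
    also have "\<dots> = (\<integral>\<^sup>+x. indicator (?K \<inter> (\<lambda>x::real^'n. 1 / norm x) -` S) x \<partial>lborel)"
      by (intro nn_integral_cong) (auto split: split_indicator)
    also have "\<dots> = emeasure lborel (?K \<inter> (\<lambda>x::real^'n. 1 / norm x) -` S)"
      using V K by (intro nn_integral_indicator) auto
    also have "?K \<inter> (\<lambda>x::real^'n. 1 / norm x) -` S = {x::real^'n. x \<noteq> 0 \<and> 1 / norm x \<in> S \<and> x /\<^sub>R norm x \<in> B}"
      by auto
    finally show ?thesis .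
  qed
  define N where "N = density (inv_radial CARD('n)) (\<lambda>_. emeasure sphere_measure0 B)"
  have emN: "emeasure N S = emeasure (inv_radial CARD('n)) S * emeasure sphere_measure0 B"
    if S: "S \<in> sets borel" for S
    unfolding N_def using S by (subst emeasure_density) (auto simp: nn_integral_cmult mult.commute[of _ "emeasure sphere_measure0 B"])
  have "L = N"
  proof (rule measure_eqI_Ioi_pos)
    show "sets L = sets borel" "sets N = sets borel" by (simp_all add: L_def N_def)
    have empty: "{x::real^'n. x \<noteq> 0 \<and> 1 / norm x \<in> {..0} \<and> x /\<^sub>R norm x \<in> B} = {}"
      by auto
    have "{..0::real} \<in> sets borel" by simp
    from emL[OF this] show "emeasure L {..0} = 0" unfolding empty by simp
    have "emeasure (inv_radial CARD('n)) {..0} = 0"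
      unfolding inv_radial_def by (subst emeasure_density) (auto simp: nn_integral_0_iff_AE split: split_indicator)
    then show "emeasure N {..0} = 0" by (subst emN) auto
    fix u :: real assume u: "u > 0"
    have r: "emeasure (inv_radial CARD('n)) {u<..} = ennreal (1 / (real CARD('n) * u ^ CARD('n)))"
      using u by (intro emeasure_inv_radial_Ioi) auto
    have 1: "emeasure L {u<..} = ennreal (1 / (real CARD('n) * u ^ CARD('n))) * emeasure sphere_measure0 B"
      using emeasure_truncated_cone[OF B u] by (subst emL) auto
    show "emeasure L {u<..} = emeasure N {u<..}"
      unfolding 1 by (subst emN) (auto simp: r)
    show "emeasure L {u<..} < \<infinity>"
      unfolding 1 using emeasure_finite[of B] by (auto simp: ennreal_mult_eq_top_iff less_top[symmetric])
  qed
  then have "emeasure (inv_radial CARD('n)) A * emeasure sphere_measure0 B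
    = emeasure lborel {x::real^'n. x \<noteq> 0 \<and> 1 / norm x \<in> A \<and> x /\<^sub>R norm x \<in> B}"
    using emL[OF A] emN[OF A] by simp
  also have "\<dots> = emeasure ?R {x::real^'n. x \<noteq> 0 \<and> 1 / norm x \<in> A \<and> x /\<^sub>R norm x \<in> B}"
    by (subst emeasure_restrict_space) auto
  also have "\<dots> = emeasure (distr ?R (borel \<Otimes>\<^sub>M restrict_space borel (sphere 0 1)) (\<lambda>x. (1 / norm x, x /\<^sub>R norm x))) (A \<times> B)"
    using A B by (subst emeasure_distr[OF measurable_inv_polar])
      (auto intro!: arg_cong[where f="emeasure _"] simp: space_restrict_space)
  finally show "emeasure (inv_radial CARD('n)) A * emeasure sphere_measure0 B
    = emeasure (distr ?R (borel \<Otimes>\<^sub>M restrict_space borel (sphere 0 1)) (\<lambda>x. (1 / norm x, x /\<^sub>R norm x))) (A \<times> B)" .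
qed

lemma measurable_sphere_dilation:
  assumes [measurable]: "F \<in> borel_measurable borel"
  shows "(\<lambda>(u, \<theta>). F (\<theta> /\<^sub>R u)) \<in> borel_measurable (borel \<Otimes>\<^sub>M (sphere_measure0 :: (real^'n) measure))"
proof -
  have [measurable]: "(\<lambda>\<theta>. \<theta>) \<in> (sphere_measure0 :: (real^'n) measure) \<rightarrow>\<^sub>M borel"
    unfolding measurable_cong_sets[OF sets_sphere_measure0 refl] by (rule measurable_restrict_space1) simp
  show ?thesis by measurable
qed

lemma nn_integral_inv_polar:
  fixes F :: "real^'n \<Rightarrow> ennreal"
  assumes F[measurable]: "F \<in> borel_measurable borel"
  shows "(\<integral>\<^sup>+x. F x \<partial>lborel) = (\<integral>\<^sup>+u. (\<integral>\<^sup>+\<theta>. F (\<theta> /\<^sub>R u) \<partial>sphere_measure0) \<partial>inv_radial CARD('n))"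
proof -
  interpret S: finite_measure "sphere_measure0 :: (real^'n) measure" by (rule finite_sphere_measure0)
  interpret R: sigma_finite_measure "inv_radial CARD('n)" by (rule sigma_finite_inv_radial)
  interpret pair_sigma_finite "inv_radial CARD('n)" "sphere_measure0 :: (real^'n) measure" ..
  let ?R = "restrict_space lborel (-{0::real^'n})"
  let ?G = "\<lambda>(u, \<theta>). F (\<theta> /\<^sub>R u)"
  have G: "?G \<in> borel_measurable (inv_radial CARD('n) \<Otimes>\<^sub>M (sphere_measure0 :: (real^'n) measure))"
    using measurable_sphere_dilation[OF F]
    by (subst measurable_cong_sets[OF sets_pair_measure_cong[OF sets_inv_radial refl] refl])
  have G': "?G \<in> borel_measurable (borel \<Otimes>\<^sub>M restrict_space borel (sphere 0 1))"
    using measurable_sphere_dilation[OF F]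
    by (subst (asm) measurable_cong_sets[OF sets_pair_measure_cong[OF refl sets_sphere_measure0] refl])
  \<comment> \<open>The origin has no direction, so it is dropped as a null set before the change of
    variables.\<close>
  have "(\<integral>\<^sup>+x. F x \<partial>lborel) = (\<integral>\<^sup>+x. F x * indicator (-{0}) x \<partial>lborel)"
  proof (rule nn_integral_cong_AE)
    show "AE x in lborel. F x = F x * indicator (-{0}) x"
      using AE_lborel_singleton[of 0] by eventually_elim (auto split: split_indicator)
  qed
  also have "\<dots> = (\<integral>\<^sup>+x. F x \<partial>?R)"
    by (subst nn_integral_restrict_space) auto
  also have "\<dots> = (\<integral>\<^sup>+x. ?G (1 / norm x, x /\<^sub>R norm x) \<partial>?R)"
    by (intro nn_integral_cong) (auto simp: space_restrict_space)
  also have "\<dots> = (\<integral>\<^sup>+z. ?G z \<partial>(inv_radial CARD('n) \<Otimes>\<^sub>M sphere_measure0))"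
    unfolding distr_inv_polar by (rule nn_integral_distr[symmetric, OF measurable_inv_polar]) (use G' in simp)
  also have "\<dots> = (\<integral>\<^sup>+u. (\<integral>\<^sup>+\<theta>. F (\<theta> /\<^sub>R u) \<partial>sphere_measure0) \<partial>inv_radial CARD('n))"
    using S.nn_integral_fst[OF G] by simp
  finally show ?thesis .
qed

section \<open>Borel versions of homogeneous functions and the Dini tail\<close>

lemma AE_inv_radial_pos: "AE u in inv_radial n. 0 < u"
  unfolding inv_radial_def by (subst AE_density) (auto split: split_indicator)

text \<open>Polar integration of the indicator of \<open>Z\<close>: a nonnegative function with
  integral 0 has almost every slice integral 0. This permits replacing a function by its Borel
  version on almost every sphere about the origin.\<close>

lemma AE_inv_polar:
  fixes Z :: "(real^'n) set"
  assumes Z: "Z \<in> null_sets lborel"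
  shows "AE u in inv_radial CARD('n). AE \<theta> in sphere_measure0. \<theta> /\<^sub>R u \<notin> Z"
proof -
  interpret S: finite_measure "sphere_measure0 :: (real^'n) measure" by (rule finite_sphere_measure0)
  have [measurable]: "Z \<in> sets borel" using Z by auto
  let ?F = "indicator Z :: real^'n \<Rightarrow> ennreal"
  have F: "?F \<in> borel_measurable borel" by simp
  have G: "(\<lambda>(u, \<theta>). ?F (\<theta> /\<^sub>R u)) \<in> borel_measurable (inv_radial CARD('n) \<Otimes>\<^sub>M (sphere_measure0 :: (real^'n) measure))"
    using measurable_sphere_dilation[OF F]
    by (subst measurable_cong_sets[OF sets_pair_measure_cong[OF sets_inv_radial refl] refl])
  have I: "(\<lambda>u. \<integral>\<^sup>+\<theta>. ?F (\<theta> /\<^sub>R u) \<partial>sphere_measure0) \<in> borel_measurable (inv_radial CARD('n))"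
    using S.borel_measurable_nn_integral_fst[OF G] by simp
  have "(\<integral>\<^sup>+u. (\<integral>\<^sup>+\<theta>. ?F (\<theta> /\<^sub>R u) \<partial>sphere_measure0) \<partial>inv_radial CARD('n)) = 0"
    using nn_integral_inv_polar[OF F] Z by auto
  then have "AE u in inv_radial CARD('n). (\<integral>\<^sup>+\<theta>. ?F (\<theta> /\<^sub>R u) \<partial>sphere_measure0) = 0"
    using nn_integral_0_iff_AE[OF I] by simp
  then show ?thesis
  proof eventually_elim
    case (elim u)
    have "(\<lambda>\<theta>. ?F (\<theta> /\<^sub>R u)) \<in> borel_measurable (sphere_measure0 :: (real^'n) measure)"
      using measurable_Pair2[OF G, of u] by (simp add: inv_radial_def)
    from nn_integral_0_iff_AE[OF this] elim
    show ?case by (auto simp: indicator_eq_0_iff)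
  qed
qed

text \<open>The indicator of a cone does not depend on the radius, so every inner integral in polar
  coordinates equals the surface measure of \<open>B\<close>, which is 0.\<close>

lemma null_sets_cone:
  fixes B :: "(real^'n) set"
  assumes B: "B \<in> null_sets sphere_measure0"
  shows "{x. x \<noteq> 0 \<and> x /\<^sub>R norm x \<in> B} \<in> null_sets lborel"
proof -
  let ?K = "{x::real^'n. x \<noteq> 0 \<and> x /\<^sub>R norm x \<in> B}"
  have Bs: "B \<in> sets (restrict_space borel (sphere 0 1))"
    using B by (simp add: null_sets_def sets_sphere_measure0)
  have K: "?K \<in> sets borel" by (rule sets_borel_cone[OF Bs])
  have "emeasure lborel ?K = (\<integral>\<^sup>+x. indicator ?K x \<partial>lborel)" using K by simp
  also have "\<dots> = (\<integral>\<^sup>+u. (\<integral>\<^sup>+\<theta>. indicator ?K (\<theta> /\<^sub>R u) \<partial>sphere_measure0) \<partial>inv_radial CARD('n))"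
    using K by (intro nn_integral_inv_polar) auto
  also have "\<dots> = (\<integral>\<^sup>+u. 0 \<partial>inv_radial CARD('n))"
  proof (rule nn_integral_cong_AE)
    show "AE u in inv_radial CARD('n). (\<integral>\<^sup>+\<theta>. indicator ?K (\<theta> /\<^sub>R u) \<partial>sphere_measure0) = 0"
      using AE_inv_radial_pos
    proof eventually_elim
      case (elim u)
      have "(\<integral>\<^sup>+\<theta>. indicator ?K (\<theta> /\<^sub>R u) \<partial>sphere_measure0) = (\<integral>\<^sup>+\<theta>. indicator B \<theta> \<partial>(sphere_measure0 :: (real^'n) measure))"
        using elim by (intro nn_integral_cong) (auto simp: space_sphere_measure0 split: split_indicator)
      then show ?case using B by (simp add: null_sets_def)
    qed
  qed
  finally show ?thesis using K by (simp add: null_sets_def)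
qed

text \<open>The hypotheses give measurability of \<Omega> only for the completed sphere measure. A
  Borel version chosen on the sphere and extended radially is Borel and homogeneous on the whole
  space, and by homogeneity of \<Omega> the two can differ only at the origin and on a cone over a
  null set of directions.\<close>

lemma homogeneous0_borel_version:
  fixes \<Omega> :: "real^'n \<Rightarrow> real"
  assumes hom: "homogeneous0 \<Omega>" and meas: "\<Omega> \<in> borel_measurable sphere_measure"
  obtains K Z where "K \<in> borel_measurable borel" "homogeneous0 K" "Z \<in> null_sets lborel"
    "\<And>x. x \<notin> Z \<Longrightarrow> \<Omega> x = K x" "AE \<theta> in sphere_measure0. \<Omega> \<theta> = K \<theta>"
proof -
  obtain g where g: "g \<in> borel_measurable sphere_measure0" "AE \<theta> in sphere_measure0. \<Omega> \<theta> = g \<theta>"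
    using completion_ex_borel_measurable_real meas unfolding sphere_measure_eq by blast
  from g(2) obtain N where N: "N \<in> null_sets sphere_measure0" "{\<theta> \<in> space sphere_measure0. \<Omega> \<theta> \<noteq> g \<theta>} \<subseteq> N"
    unfolding eventually_ae_filter by auto
  \<comment> \<open>\<open>g\<close> is controlled only on the sphere; extension by zero makes it
    Borel on the whole space.\<close>
  define h where "h x = indicator (sphere 0 1) x *\<^sub>R g x" for x :: "real^'n"
  have "g \<in> borel_measurable (restrict_space borel (sphere 0 1))"
    using g(1) unfolding measurable_cong_sets[OF sets_sphere_measure0 refl] .
  then have [measurable]: "h \<in> borel_measurable borel"
    unfolding h_def by (subst (asm) borel_measurable_restrict_space_iff) auto
  define K where "K x = h (x /\<^sub>R norm x)" for x
  \<comment> \<open>The origin belongs to \<open>Z\<close> because homogeneity says nothing about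
    the value of \<Omega> there.\<close>
  define Z where "Z = {0} \<union> {x. x \<noteq> 0 \<and> x /\<^sub>R norm x \<in> N}"
  show ?thesis
  proof
    show "K \<in> borel_measurable borel" unfolding K_def by simp
    show "homogeneous0 K" unfolding homogeneous0_def
    proof (intro allI impI)
      fix s :: real and x :: "real^'n" assume "s > 0"
      then have "(s *\<^sub>R x) /\<^sub>R norm (s *\<^sub>R x) = x /\<^sub>R norm x" by simp
      then show "K (s *\<^sub>R x) = K x" by (simp only: K_def)
    qed
    show "Z \<in> null_sets lborel"
      unfolding Z_def by (intro null_sets.Un null_sets_cone[OF N(1)]) auto
    show "AE \<theta> in sphere_measure0. \<Omega> \<theta> = K \<theta>"
      using g(2) AE_space
    proof eventually_elim
      case (elim \<theta>)
      then have "norm \<theta> = 1" by (simp add: space_sphere_measure0)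
      then show ?case using elim by (simp add: K_def h_def)
    qed
    fix x assume "x \<notin> Z"
    then have x: "x \<noteq> 0" "x /\<^sub>R norm x \<notin> N" by (auto simp: Z_def)
    have u: "x /\<^sub>R norm x \<in> sphere 0 1" using x by auto
    have "g (x /\<^sub>R norm x) = \<Omega> (x /\<^sub>R norm x)"
    proof (rule ccontr)
      assume "g (x /\<^sub>R norm x) \<noteq> \<Omega> (x /\<^sub>R norm x)"
      then have "x /\<^sub>R norm x \<in> {\<theta> \<in> space sphere_measure0. \<Omega> \<theta> \<noteq> g \<theta>}"
        using u by (simp add: space_sphere_measure0)
      then show False using N(2) x(2) by (meson subsetD)
    qed
    also have "\<dots> = \<Omega> x" using hom x(1) by (simp add: homogeneous0_def)
    finally show "\<Omega> x = K x" unfolding K_def h_def using u by (simp add: indicator_def)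
  qed
qed

section \<open>The integral modulus of continuity and the tail of the Dini integral\<close>

lemma modulus_one: "modulus 1 \<Omega> t = (SUP h \<in> cball 0 t. \<integral>\<^sup>+x. ennreal \<bar>\<Omega> (x + h) - \<Omega> x\<bar> \<partial>sphere_measure)"
proof -
  have "ennroot 1 a = a" for a by (cases a) (auto simp: ennroot_def)
  then show ?thesis by (simp add: modulus_def)
qed

text \<open>Monotonicity is the source of measurability: the modulus is a supremum over uncountably
  many translations, but superlevel sets of a monotone function are intervals.\<close>

lemma mono_modulus_one: "mono (modulus 1 \<Omega>)"
  by (auto simp: modulus_one mono_def intro!: SUP_subset_mono)

lemma borel_measurable_mono_ennreal:
  fixes f :: "real \<Rightarrow> ennreal"
  assumes "mono f"
  shows "f \<in> borel_measurable borel"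
proof (rule borel_measurableI_greater)
  fix y
  have "is_interval {x. y < f x}"
    unfolding is_interval_1 using monoD[OF assms] by (meson mem_Collect_eq order_less_le_trans)
  then have "{x. y < f x} \<in> sets borel" by (rule real_interval_borel_measurable)
  then show "{x \<in> space borel. y < f x} \<in> sets borel" by simp
qed

text \<open>The substitution t = \<delta> u turns the integral into \<delta>^\<alpha> times the Dini
  integral over (0, \<delta>/\<rho>]. For \<delta> \<le> 1 the factor is at most 1, and the tail of
  a convergent integral vanishes.\<close>

lemma Dini_tail:
  fixes \<Omega> :: "real^'n \<Rightarrow> real"
  assumes "0 \<le> \<alpha>" and dini: "Dini 1 \<alpha> \<Omega>" and \<rho>: "0 < \<rho>"
  shows "((\<lambda>\<delta>. \<integral>\<^sup>+u\<in>{0<..1/\<rho>}. modulus 1 \<Omega> (\<delta> * u) / ennreal (u powr (1 + \<alpha>)) \<partial>lborel) \<longlongrightarrow> 0) (at_right 0)"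
proof -
  let ?\<phi> = "\<lambda>t. modulus 1 \<Omega> t / ennreal (t powr (1 + \<alpha>))"
  let ?T = "\<lambda>\<delta>. \<integral>\<^sup>+u\<in>{0<..1/\<rho>}. modulus 1 \<Omega> (\<delta> * u) / ennreal (u powr (1 + \<alpha>)) \<partial>lborel"
  have [measurable]: "modulus 1 \<Omega> \<in> borel_measurable borel"
    by (rule borel_measurable_mono_ennreal[OF mono_modulus_one])
  have T: "?T \<delta> \<le> (\<integral>\<^sup>+t\<in>{0<..\<delta>/\<rho>}. ?\<phi> t \<partial>lborel)" if \<delta>: "0 < \<delta>" "\<delta> \<le> 1" for \<delta>
  proof -
    have "(\<integral>\<^sup>+t\<in>{0<..\<delta>/\<rho>}. ?\<phi> t \<partial>lborel) =
      ennreal \<bar>\<delta>\<bar> * (\<integral>\<^sup>+u. ?\<phi> (0 + \<delta> * u) * indicator {0<..\<delta>/\<rho>} (0 + \<delta> * u) \<partial>lborel)"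
      using \<delta> by (intro nn_integral_real_affine) auto
    also have "\<dots> = (\<integral>\<^sup>+u. ennreal \<delta> * (?\<phi> (\<delta> * u) * indicator {0<..\<delta>/\<rho>} (\<delta> * u)) \<partial>lborel)"
      using \<delta> by (subst nn_integral_cmult) auto
    also have "\<dots> \<ge> ?T \<delta>"
    proof (rule nn_integral_mono)
      fix u :: real
      show "modulus 1 \<Omega> (\<delta> * u) / ennreal (u powr (1 + \<alpha>)) * indicator {0<..1/\<rho>} u
        \<le> ennreal \<delta> * (?\<phi> (\<delta> * u) * indicator {0<..\<delta>/\<rho>} (\<delta> * u))"
      proof (cases "u \<in> {0<..1/\<rho>}")
        case True
        then have u: "0 < u" "u \<le> 1 / \<rho>" by auto
        have i: "\<delta> * u \<in> {0<..\<delta>/\<rho>}" using u \<delta> \<rho> by (auto simp: field_simps)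
        \<comment> \<open>One power of \<delta> is the Jacobian; the surplus factor
          \<delta>^\<alpha> is bounded by 1.\<close>
        have "\<delta> powr (1 + \<alpha>) \<le> \<delta>" using \<delta> \<open>0 \<le> \<alpha>\<close> by (simp add: powr_add powr_le1 mult_left_le)
        then have "(\<delta> * u) powr (1 + \<alpha>) \<le> \<delta> * u powr (1 + \<alpha>)"
          using u \<delta> by (simp add: powr_mult mult_right_mono)
        then have le: "1 / u powr (1 + \<alpha>) \<le> \<delta> * (1 / (\<delta> * u) powr (1 + \<alpha>))"
          using u \<delta> by (simp add: field_simps)
        have d: "A / ennreal r = A * ennreal (1 / r)" if "r > 0" for A r
          using that by (simp add: divide_ennreal_def inverse_ennreal divide_inverse)
        have "modulus 1 \<Omega> (\<delta> * u) / ennreal (u powr (1 + \<alpha>)) = modulus 1 \<Omega> (\<delta> * u) * ennreal (1 / u powr (1 + \<alpha>))"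
          using u by (simp add: d)
        also have "\<dots> \<le> modulus 1 \<Omega> (\<delta> * u) * ennreal (\<delta> * (1 / (\<delta> * u) powr (1 + \<alpha>)))"
          using le by (intro mult_left_mono ennreal_leI) auto
        also have "\<dots> = ennreal \<delta> * (modulus 1 \<Omega> (\<delta> * u) * ennreal (1 / (\<delta> * u) powr (1 + \<alpha>)))"
          using \<delta> u by (subst ennreal_mult) (auto simp: mult_ac)
        also have "\<dots> = ennreal \<delta> * ?\<phi> (\<delta> * u)" using \<delta> u by (subst d[symmetric]) auto
        finally show ?thesis using True i by simp
      qed simp
    qed
    finally show ?thesis .
  qed
  \<comment> \<open>Viewed as a finite measure \<open>M\<close>, the Dini integral has vanishing
    tails by continuity from above. The half-lines below decrease to {..0}, which has
    \<open>M\<close>-mass 0 because the density lives on (0, 1].\<close>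
  define M where "M = density lborel (\<lambda>t. ?\<phi> t * indicator {0<..1} t)"
  have Mval: "emeasure M {..s} = (\<integral>\<^sup>+t\<in>{0<..s}. ?\<phi> t \<partial>lborel)" if "s \<le> 1" for s
    unfolding M_def using that
    by (subst emeasure_density) (auto intro!: nn_integral_cong split: split_indicator)
  have fin: "emeasure M A < \<infinity>" if "A \<in> sets borel" for A
  proof -
    have "emeasure M A \<le> emeasure M UNIV" by (intro emeasure_mono) (auto simp: M_def)
    also have "\<dots> = (\<integral>\<^sup>+t\<in>{0<..1}. ?\<phi> t \<partial>lborel)" unfolding M_def by (subst emeasure_density) auto
    also have "\<dots> < \<infinity>" using dini by (simp add: Dini_def)
    finally show ?thesis .
  qed
  let ?A = "\<lambda>k::nat. {..1 / real (Suc k)}"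
  have "(\<lambda>k. emeasure M (?A k)) \<longlonglongrightarrow> emeasure M (\<Inter>k. ?A k)"
  proof (rule Lim_emeasure_decseq)
    show "range ?A \<subseteq> sets M" by (auto simp: M_def)
    show "decseq ?A" by (auto simp: decseq_def frac_le intro: order_trans)
    show "emeasure M (?A k) \<noteq> \<infinity>" for k using fin[of "?A k"] by auto
  qed
  also have "(\<Inter>k. ?A k) = {..0}"
  proof (intro set_eqI iffI)
    fix x assume x: "x \<in> (\<Inter>k. ?A k)"
    show "x \<in> {..0}"
    proof (rule ccontr)
      assume "x \<notin> {..0}"
      then have "0 < x" by simp
      then obtain k where "1 / real (Suc k) < x" using nat_approx_posE by (metis of_nat_Suc)
      moreover have "x \<le> 1 / real (Suc k)" using x by blast
      ultimately show False by simp
    qed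
  qed (auto intro: order_trans)
  also have "emeasure M {..0} = 0" by (subst Mval) auto
  finally have lim: "(\<lambda>k. emeasure M (?A k)) \<longlonglongrightarrow> 0" .
  show ?thesis
  proof (rule order_tendstoI)
    fix e :: ennreal assume "0 < e"
    then have "eventually (\<lambda>k. emeasure M (?A k) < e) sequentially"
      using order_tendstoD(2)[OF lim] by simp
    then obtain k where k: "emeasure M (?A k) < e" by (auto simp: eventually_sequentially)
    have "eventually (\<lambda>\<delta>::real. 0 < \<delta> \<and> \<delta> < min 1 (\<rho> / real (Suc k))) (at_right 0)"
      using \<rho> by (intro eventually_at_right_less[of 0, THEN eventually_conj] order_tendstoD(2)[OF tendsto_ident_at]) (auto)
    then show "eventually (\<lambda>\<delta>. ?T \<delta> < e) (at_right 0)"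
    proof eventually_elim
      case (elim \<delta>)
      have s: "\<delta> / \<rho> \<le> 1 / real (Suc k)" using elim \<rho> by (simp add: field_simps)
      have s1: "\<delta> / \<rho> \<le> 1" using s by (rule order_trans) simp
      have "?T \<delta> \<le> emeasure M {..\<delta> / \<rho>}" unfolding Mval[OF s1] using T[of \<delta>] elim by simp
      also have "\<dots> \<le> emeasure M (?A k)" using s by (intro emeasure_mono) (auto simp: M_def)
      finally show ?case using k by simp
    qed
  qed simp
qed

section \<open>Finite absolutely continuous measures\<close>

definition ac_finite :: "(real^'n) measure \<Rightarrow> bool" where
  "ac_finite W \<longleftrightarrow> sets W = sets lebesgue \<and> finite_measure W \<and> absolutely_continuous lebesgue W"

lemma null_sets_reflect:
  fixes Z :: "'a::euclidean_space set"
  assumes "Z \<in> null_sets lborel"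
  shows "{y. x - y \<in> Z} \<in> null_sets lborel"
proof -
  have Z: "Z \<in> sets borel" "emeasure lborel Z = 0" using assms by auto
  have eq: "{y. x - y \<in> Z} = (\<lambda>z. (-1) *\<^sub>R z + x) ` Z"
  proof (intro set_eqI iffI)
    fix y assume "y \<in> {y. x - y \<in> Z}"
    then have "x - y \<in> Z" "y = (-1) *\<^sub>R (x - y) + x" by simp_all
    then show "y \<in> (\<lambda>z. (-1) *\<^sub>R z + x) ` Z" by (rule rev_image_eqI)
  next
    fix y assume "y \<in> (\<lambda>z. (-1) *\<^sub>R z + x) ` Z"
    then obtain z where "z \<in> Z" "y = (-1) *\<^sub>R z + x" by (rule imageE)
    then show "y \<in> {y. x - y \<in> Z}" by simp
  qed
  have s: "{y. x - y \<in> Z} \<in> sets borel"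
    using measurable_sets[of "\<lambda>y. x - y" borel borel Z] Z by (simp add: vimage_def)
  have "emeasure lebesgue {y. x - y \<in> Z} = ennreal (\<bar>-1\<bar> ^ DIM('a)) * emeasure lebesgue Z"
    unfolding eq by (rule emeasure_lebesgue_affine)
  then show ?thesis using s Z by (simp add: null_sets_def)
qed

lemma ac_finite_AE:
  assumes "ac_finite W" "N \<in> null_sets lborel"
  shows "AE y in W. y \<notin> N"
  using assms null_sets_completionI[of N lborel] by (intro AE_not_in) (auto simp: ac_finite_def absolutely_continuous_def)

lemma ac_finite_measurable: "ac_finite W \<Longrightarrow> f \<in> borel_measurable borel \<Longrightarrow> f \<in> borel_measurable W"
  by (subst measurable_cong_sets[of W lebesgue]) (auto simp: ac_finite_def measurable_completion)

lemma ac_finite_space: "ac_finite W \<Longrightarrow> space W = UNIV"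
  using sets_eq_imp_space_eq[of W lebesgue] by (simp add: ac_finite_def)

lemma ac_finite_emeasure: "ac_finite W \<Longrightarrow> emeasure W A = ennreal (measure W A)"
  by (intro finite_measure.emeasure_eq_measure) (simp add: ac_finite_def)

lemma ac_finite_density_indicator:
  assumes W: "ac_finite W" and A: "A \<in> sets borel"
  shows "ac_finite (density W (indicator A))"
proof -
  have AW: "A \<in> sets W" using assms by (simp add: ac_finite_def)
  have e: "emeasure (density W (indicator A)) B = emeasure W (A \<inter> B)" if "B \<in> sets W" for B
    using AW that by (subst emeasure_density) (auto simp: nn_integral_indicator[symmetric] simp del: nn_integral_indicator intro!: nn_integral_cong split: split_indicator)
  interpret finite_measure W using W by (simp add: ac_finite_def)
  have "finite_measure (density W (indicator A))"
    by (rule finite_measureI) (simp add: e sets.top emeasure_finite)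
  moreover have "B \<in> null_sets (density W (indicator A))" if "B \<in> null_sets lebesgue" for B
  proof -
    have B: "B \<in> null_sets W" using W that by (auto simp: ac_finite_def absolutely_continuous_def)
    then have "emeasure W (A \<inter> B) \<le> 0"
      using emeasure_mono[of "A \<inter> B" B W] by (auto simp: null_sets_def)
    then show ?thesis using B e[of B] by (auto simp: null_sets_def)
  qed
  ultimately show ?thesis using W by (auto simp: ac_finite_def absolutely_continuous_def)
qed

section \<open>Translation bound for a rough kernel\<close>

text \<open>\<open>K\<close> is a Borel version of \<Omega>, and the agreement is recorded twice:
  off the null set \<open>Z\<close> for integrals over the whole space, and almost everywhere on the
  sphere, since the sphere is itself Lebesgue null and agreement off an arbitrary null set says
  nothing there.\<close>

locale rough_kernel =
  fixes \<alpha> a p :: real and \<Omega> K :: "real^'n \<Rightarrow> real" and Z :: "(real^'n) set"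
  assumes \<alpha>_nonneg: "0 \<le> \<alpha>" and a_pos: "0 < a" and a_eq: "a = real CARD('n) - \<alpha>"
    and p_eq: "p = real CARD('n) / a"
    and hom: "homogeneous0 \<Omega>" and dini: "Dini 1 \<alpha> \<Omega>"
    and K[measurable]: "K \<in> borel_measurable borel"
    and K_hom: "homogeneous0 K" and AE_sphere: "AE \<theta> in sphere_measure0. \<Omega> \<theta> = K \<theta>"
    and Z: "Z \<in> null_sets lborel" and \<Omega>_eq_K: "\<And>x. x \<notin> Z \<Longrightarrow> \<Omega> x = K x"
begin

definition Dini_rest :: "real \<Rightarrow> real \<Rightarrow> ennreal" where
  "Dini_rest \<rho> \<delta> = (\<integral>\<^sup>+u\<in>{0<..1/\<rho>}. modulus 1 \<Omega> (\<delta> * u) / ennreal (u powr (1 + \<alpha>)) \<partial>lborel)"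

lemma Dini_rest_tendsto: "0 < \<rho> \<Longrightarrow> (Dini_rest \<rho> \<longlongrightarrow> 0) (at_right 0)"
  using Dini_tail[OF \<alpha>_nonneg dini] by (simp add: Dini_rest_def[abs_def])

text \<open>With x = \<theta>/u, homogeneity turns \<Omega>(\<theta>/u - y) into \<Omega>(\<theta> -
  u y), so the integral over the sphere of radius 1/u is an \<Omega>-translation by a vector of
  length at most \<delta> u and is bounded by the modulus. The weight u^a from |x|^(-a) times the
  radial density u^(-n-1) leaves u^(-1-\<alpha>).\<close>

lemma translation_bound:
  assumes y: "norm y \<le> \<delta>" and \<delta>: "\<delta> < \<rho>"
  shows "(\<integral>\<^sup>+x. ennreal (\<bar>K (x - y) - K x\<bar> / norm x powr a) * indicator {x. \<rho> \<le> norm x} x \<partial>lborel)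
    \<le> Dini_rest \<rho> \<delta>"
proof -
  interpret S: finite_measure "sphere_measure0 :: (real^'n) measure" by (rule finite_sphere_measure0)
  have \<rho>: "0 < \<rho>" using assms norm_ge_zero[of y] by linarith
  let ?F = "\<lambda>x. ennreal (\<bar>K (x - y) - K x\<bar> / norm x powr a) * indicator {x. \<rho> \<le> norm x} x"
  let ?I = "\<lambda>u. \<integral>\<^sup>+\<theta>. ?F (\<theta> /\<^sub>R u) \<partial>sphere_measure0"
  let ?w = "\<lambda>u::real. ennreal (indicator {0<..} u * (1 / u ^ Suc CARD('n)))"
  have F: "?F \<in> borel_measurable borel" by measurable
  have G: "(\<lambda>(u, \<theta>). ?F (\<theta> /\<^sub>R u)) \<in> borel_measurable (borel \<Otimes>\<^sub>M (sphere_measure0 :: (real^'n) measure))"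
    by (rule measurable_sphere_dilation[OF F])
  have I: "?I \<in> borel_measurable borel"
    using S.borel_measurable_nn_integral_fst[OF G] by simp
  have Zy: "{x. x - y \<in> Z} \<in> null_sets lborel"
    by (rule null_sets_translation[OF Z])
  \<comment> \<open>The modulus is defined through \<Omega>, while the left side uses
    \<open>K\<close>. For almost every u both evaluation points avoid \<open>Z\<close> for almost
    every \<theta>, so the two may be exchanged.\<close>
  have "AE u in inv_radial CARD('n). AE \<theta> in sphere_measure0. \<theta> /\<^sub>R u \<notin> Z \<union> {x. x - y \<in> Z}"
    by (rule AE_inv_polar) (rule null_sets.Un[OF Z Zy])
  then have AE_u: "AE u in lborel. 0 < u \<longrightarrow> (AE \<theta> in sphere_measure0. \<theta> /\<^sub>R u \<notin> Z \<and> \<theta> /\<^sub>R u - y \<notin> Z)"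
    unfolding inv_radial_def by (subst (asm) AE_density) (auto split: split_indicator_asm elim!: eventually_mono)
  have "(\<integral>\<^sup>+x. ?F x \<partial>lborel) = (\<integral>\<^sup>+u. ?I u \<partial>inv_radial CARD('n))"
    by (rule nn_integral_inv_polar[OF F])
  also have "\<dots> = (\<integral>\<^sup>+u. ?w u * ?I u \<partial>lborel)"
    unfolding inv_radial_def using I by (intro nn_integral_density) auto
  also have "\<dots> \<le> (\<integral>\<^sup>+u. modulus 1 \<Omega> (\<delta> * u) / ennreal (u powr (1 + \<alpha>)) * indicator {0<..1/\<rho>} u \<partial>lborel)"
  proof (rule nn_integral_mono_AE)
    show "AE u in lborel. ?w u * ?I u \<le> modulus 1 \<Omega> (\<delta> * u) / ennreal (u powr (1 + \<alpha>)) * indicator {0<..1/\<rho>} u"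
      using AE_u
    proof eventually_elim
      case (elim u)
      have norm_u: "norm (\<theta> /\<^sub>R u) = 1 / u" if "0 < u" "\<theta> \<in> sphere 0 1" for \<theta> :: "real^'n"
        using that by (simp add: divide_inverse)
      show ?case
      proof (cases "0 < u \<and> u \<le> 1 / \<rho>")
        case False
        consider "u \<le> 0" | "1 / \<rho> < u" "0 < u" using False by linarith
        then show ?thesis
        proof cases
          case 1 then show ?thesis by simp
        next
          case 2
          then have "1 / u < \<rho>" using \<rho> by (simp add: field_simps)
          then have "?I u = (\<integral>\<^sup>+\<theta>. 0 \<partial>(sphere_measure0 :: (real^'n) measure))"
            using norm_u[OF 2(2)] by (intro nn_integral_cong) (simp add: space_sphere_measure0)
          then show ?thesis by simp
        qed
      next
        case True
        then have u: "0 < u" "u \<le> 1 / \<rho>" by auto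
        have ae: "AE \<theta> in sphere_measure0. \<theta> /\<^sub>R u \<notin> Z \<and> \<theta> /\<^sub>R u - y \<notin> Z" using elim u by simp
        let ?h = "- (u *\<^sub>R y)"
        \<comment> \<open>The chain gives |u y| < 1. Hence \<theta> - u y is nonzero for every unit
          vector \<theta>, and homogeneity applies to it.\<close>
        have uy: "u * norm y \<le> \<delta> * u" using y u by (simp add: mult.commute)
        note uy
        also have "\<delta> * u < \<rho> * u" using \<delta> u by simp
        also have "\<rho> * u \<le> 1" using u \<rho> by (simp add: field_simps)
        finally have h1: "norm ?h < 1" using u by simp
        have Km: "(\<lambda>\<theta>. ennreal \<bar>K (\<theta> /\<^sub>R u - y) - K (\<theta> /\<^sub>R u)\<bar>) \<in> borel_measurable (sphere_measure0 :: (real^'n) measure)"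
        proof -
          have "(\<lambda>x. ennreal \<bar>K (x - y) - K x\<bar>) \<in> borel_measurable borel" by measurable
          from measurable_Pair2[OF measurable_sphere_dilation[OF this], of u] show ?thesis by simp
        qed
        have "?I u = (\<integral>\<^sup>+\<theta>. ennreal (u powr a) * ennreal \<bar>K (\<theta> /\<^sub>R u - y) - K (\<theta> /\<^sub>R u)\<bar> \<partial>sphere_measure0)"
        proof (rule nn_integral_cong)
          fix \<theta> :: "real^'n" assume "\<theta> \<in> space sphere_measure0"
          then have \<theta>: "\<theta> \<in> sphere 0 1" by (simp add: space_sphere_measure0)
          have "\<rho> \<le> 1 / u" using u \<rho> by (simp add: field_simps)
          then have ind: "indicator {x. \<rho> \<le> norm x} (\<theta> /\<^sub>R u) = (1::ennreal)"
            unfolding indicator_def using norm_u[OF u(1) \<theta>] by simp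
          have d: "t / (1 / u) powr a = u powr a * t" for t using u by (simp add: powr_divide)
          show "?F (\<theta> /\<^sub>R u) = ennreal (u powr a) * ennreal \<bar>K (\<theta> /\<^sub>R u - y) - K (\<theta> /\<^sub>R u)\<bar>"
            unfolding ind unfolding norm_u[OF u(1) \<theta>] d by (simp add: ennreal_mult)
        qed
        also have "\<dots> = ennreal (u powr a) * (\<integral>\<^sup>+\<theta>. ennreal \<bar>K (\<theta> /\<^sub>R u - y) - K (\<theta> /\<^sub>R u)\<bar> \<partial>sphere_measure0)"
          by (rule nn_integral_cmult[OF Km])
        also have "(\<integral>\<^sup>+\<theta>. ennreal \<bar>K (\<theta> /\<^sub>R u - y) - K (\<theta> /\<^sub>R u)\<bar> \<partial>sphere_measure0)
          = (\<integral>\<^sup>+\<theta>. ennreal \<bar>\<Omega> (\<theta> + ?h) - \<Omega> \<theta>\<bar> \<partial>sphere_measure0)"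
        proof (rule nn_integral_cong_AE)
          show "AE \<theta> in sphere_measure0. ennreal \<bar>K (\<theta> /\<^sub>R u - y) - K (\<theta> /\<^sub>R u)\<bar> = ennreal \<bar>\<Omega> (\<theta> + ?h) - \<Omega> \<theta>\<bar>"
            using ae AE_space
          proof eventually_elim
            case (elim \<theta>)
            then have \<theta>: "\<theta> \<in> sphere 0 1" by (simp add: space_sphere_measure0)
            have "\<theta> + ?h \<noteq> 0" using h1 \<theta> by (auto simp: add_eq_0_iff)
            then have "\<Omega> (inverse u *\<^sub>R (\<theta> + ?h)) = \<Omega> (\<theta> + ?h)"
              using hom u by (simp add: homogeneous0_def)
            moreover have "inverse u *\<^sub>R (\<theta> + ?h) = \<theta> /\<^sub>R u - y"
              using u by (simp add: scaleR_diff_right)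
            ultimately have 1: "K (\<theta> /\<^sub>R u - y) = \<Omega> (\<theta> + ?h)" using elim(1) \<Omega>_eq_K by metis
            have "\<theta> \<noteq> 0" using \<theta> by auto
            then have "\<Omega> (inverse u *\<^sub>R \<theta>) = \<Omega> \<theta>" using hom u by (simp add: homogeneous0_def)
            then have 2: "K (\<theta> /\<^sub>R u) = \<Omega> \<theta>" using elim(1) \<Omega>_eq_K by metis
            show ?case unfolding 1 2 ..
          qed
        qed
        also have "\<dots> = (\<integral>\<^sup>+\<theta>. ennreal \<bar>\<Omega> (\<theta> + ?h) - \<Omega> \<theta>\<bar> \<partial>sphere_measure)"
          by (simp add: sphere_measure_eq nn_integral_completion)
        also have "\<dots> \<le> modulus 1 \<Omega> (\<delta> * u)"
          unfolding modulus_one using uy u by (intro SUP_upper) simp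
        finally have "?I u \<le> ennreal (u powr a) * modulus 1 \<Omega> (\<delta> * u)"
          by (simp add: mult_left_mono)
        then have "?w u * ?I u \<le> ?w u * (ennreal (u powr a) * modulus 1 \<Omega> (\<delta> * u))"
          by (rule mult_left_mono) simp
        also have "\<dots> = (?w u * ennreal (u powr a)) * modulus 1 \<Omega> (\<delta> * u)" by (simp add: mult.assoc)
        also have "?w u * ennreal (u powr a) = ennreal (1 / u powr (1 + \<alpha>))"
        proof -
          \<comment> \<open>Exponent count: n + 1 = a + (1 + \<alpha>), because a = n -
            \<alpha>.\<close>
          have "u ^ Suc CARD('n) = u powr a * u powr (1 + \<alpha>)"
            using u by (simp add: a_eq powr_add[symmetric] powr_realpow[symmetric] add.commute del: power_Suc)
          then show ?thesis using u by (simp add: ennreal_mult[symmetric] del: power_Suc)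
        qed
        finally show ?thesis
          using u by (simp add: divide_ennreal_def inverse_ennreal divide_inverse mult.commute)
      qed
    qed
  qed
  finally show ?thesis by (simp add: Dini_rest_def)
qed

end

section \<open>Outer measure and weak type bounds\<close>

text \<open>Superlevel sets of the maximal function are not shown to be measurable, so they are
  handled by outer measure; this identification supplies monotonicity and attainment by a measurable
  hull.\<close>

lemma leb_outer_eq_outer_measure: "leb_outer = outer_measure_of lebesgue"
  by (auto simp: leb_outer_def outer_measure_of_def fun_eq_iff)

lemma leb_outer_mono: "A \<subseteq> B \<Longrightarrow> leb_outer A \<le> leb_outer B"
  unfolding leb_outer_eq_outer_measure by (rule outer_measure_of_mono)

lemma leb_outer_sets: "A \<in> sets lebesgue \<Longrightarrow> leb_outer A = emeasure lebesgue A"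
  unfolding leb_outer_eq_outer_measure by simp

lemma leb_outer_borel: "A \<in> sets borel \<Longrightarrow> leb_outer A = emeasure lborel A"
  by (subst leb_outer_sets) auto

lemma leb_outer_null: "A \<in> null_sets lborel \<Longrightarrow> leb_outer A = 0"
  by (subst leb_outer_borel) auto

text \<open>Both infima are attained by measurable hulls, for which subadditivity is that of the
  measure.\<close>

lemma leb_outer_Un: "leb_outer (A \<union> B) \<le> leb_outer A + leb_outer B"
proof -
  obtain E where E: "E \<in> sets lebesgue" "A \<subseteq> E" "leb_outer A = emeasure lebesgue E"
    using outer_measure_of_attain[of A lebesgue] unfolding leb_outer_eq_outer_measure by auto
  obtain F where F: "F \<in> sets lebesgue" "B \<subseteq> F" "leb_outer B = emeasure lebesgue F"
    using outer_measure_of_attain[of B lebesgue] unfolding leb_outer_eq_outer_measure by auto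
  have "leb_outer (A \<union> B) \<le> leb_outer (E \<union> F)" using E F by (intro leb_outer_mono) auto
  also have "\<dots> = emeasure lebesgue (E \<union> F)" using E F by (intro leb_outer_sets) auto
  also have "\<dots> \<le> emeasure lebesgue E + emeasure lebesgue F" using E F by (intro emeasure_subadditive)
  finally show ?thesis using E F by simp
qed

lemma leb_outer_le_sum3:
  assumes "S \<subseteq> A \<union> B \<union> C"
  shows "leb_outer S \<le> leb_outer A + leb_outer B + leb_outer C"
proof -
  have "leb_outer S \<le> leb_outer (A \<union> B \<union> C)" by (rule leb_outer_mono[OF assms])
  also have "\<dots> \<le> leb_outer (A \<union> B) + leb_outer C" by (rule leb_outer_Un)
  also have "\<dots> \<le> leb_outer A + leb_outer B + leb_outer C" by (intro add_right_mono leb_outer_Un)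
  finally show ?thesis .
qed

lemma weak_norm_leI:
  assumes p: "0 < p" and B: "0 \<le> B"
    and le: "\<And>l. 0 < l \<Longrightarrow> leb_outer {x. ennreal l < g x} \<le> ennreal ((B / l) powr p)"
  shows "weak_norm p g \<le> ennreal B"
  unfolding weak_norm_def
proof (rule SUP_least)
  fix l :: real assume "l \<in> {0<..}"
  then have l: "0 < l" by simp
  let ?L = "leb_outer {x. ennreal l < g x}"
  have fin: "?L < \<infinity>" using le[OF l] by (auto intro: le_less_trans)
  have "enn2real ?L \<le> (B / l) powr p" using le[OF l] by (simp add: enn2real_leI)
  then have "enn2real ?L powr (1 / p) \<le> ((B / l) powr p) powr (1 / p)"
    using p by (intro powr_mono2) auto
  also have "\<dots> = B / l" using p B l by (simp add: powr_powr)
  finally have "l * enn2real ?L powr (1 / p) \<le> B" using l by (simp add: field_simps)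
  then show "ennreal l * ennroot p ?L \<le> ennreal B"
    using fin l by (auto simp: ennroot_def ennreal_mult[symmetric] intro: ennreal_leI)
qed

lemma weak_norm_leD:
  assumes p: "0 < p" and B: "0 \<le> B" and le: "weak_norm p g \<le> ennreal B" and l: "0 < l"
  shows "leb_outer {x. ennreal l < g x} \<le> ennreal ((B / l) powr p)"
proof -
  let ?L = "leb_outer {x. ennreal l < g x}"
  have "ennreal l * ennroot p ?L \<le> weak_norm p g"
    unfolding weak_norm_def using l by (intro SUP_upper2[where i = l]) auto
  also note le
  finally have *: "ennreal l * ennroot p ?L \<le> ennreal B" .
  \<comment> \<open>Finiteness must come first: \<open>ennroot\<close> treats \<infinity>
    separately, and \<open>enn2real\<close> sends it to 0, so the real computation below would
    otherwise lose it.\<close>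
  have fin: "?L \<noteq> \<infinity>"
  proof
    assume "?L = \<infinity>"
    then have "ennreal l * ennroot p ?L = \<infinity>" using l by (simp add: ennroot_def ennreal_mult_top)
    with * show False by (simp add: top_unique)
  qed
  have "ennreal (l * enn2real ?L powr (1 / p)) \<le> ennreal B"
    using * fin l by (simp add: ennroot_def ennreal_mult)
  then have "l * enn2real ?L powr (1 / p) \<le> B" using B by simp
  then have "enn2real ?L powr (1 / p) \<le> B / l" using l by (simp add: field_simps)
  then have "(enn2real ?L powr (1 / p)) powr p \<le> (B / l) powr p" using p by (intro powr_mono2) auto
  then have "enn2real ?L \<le> (B / l) powr p" using p by (simp add: powr_powr)
  then have "ennreal (enn2real ?L) \<le> ennreal ((B / l) powr p)" by (rule ennreal_leI)
  moreover have "ennreal (enn2real ?L) = ?L" using fin by (simp add: less_top)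
  ultimately show ?thesis by metis
qed

lemma sigma_finite_lebesgue: "sigma_finite_measure (lebesgue :: 'a::euclidean_space measure)"
proof
  obtain A :: "'a set set" where A: "countable A" "A \<subseteq> sets lborel" "\<Union>A = space lborel" "\<forall>a\<in>A. emeasure lborel a \<noteq> \<infinity>"
    using sigma_finite_measure.sigma_finite_countable[OF sigma_finite_lborel] by blast
  have s: "a \<in> sets borel" if "a \<in> A" for a using A that by auto
  show "\<exists>A :: 'a set set. countable A \<and> A \<subseteq> sets lebesgue \<and> \<Union>A = space lebesgue \<and> (\<forall>a\<in>A. emeasure lebesgue a \<noteq> \<infinity>)"
    using A s by (intro exI[of _ A]) auto
qed

text \<open>The operator norm is a supremum over functions; by Radon-Nikodym \<open>W\<close> is
  given by an integrable density, finite almost everywhere, so its real-valued version is an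
  admissible test function with the same maximal function.\<close>

lemma weak_norm_maxop_le:
  fixes \<Omega> :: "real^'n \<Rightarrow> real" and W :: "(real^'n) measure"
  assumes fin: "maxop_norm \<alpha> \<Omega> < \<infinity>" and W: "ac_finite W"
  shows "weak_norm (real CARD('n) / (real CARD('n) - \<alpha>)) (maxop \<alpha> \<Omega> W)
     \<le> ennreal (enn2real (maxop_norm \<alpha> \<Omega>) * measure W UNIV)"
proof -
  let ?p = "real CARD('n) / (real CARD('n) - \<alpha>)"
  interpret L: sigma_finite_measure "lebesgue :: (real^'n) measure" by (rule sigma_finite_lebesgue)
  obtain g where g: "g \<in> borel_measurable lebesgue" "density lebesgue g = W"
    using L.Radon_Nikodym[of W] W by (auto simp: ac_finite_def)
  have m: "(\<integral>\<^sup>+y. g y \<partial>lebesgue) = emeasure W UNIV"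
    unfolding g(2)[symmetric] using g(1) by (subst emeasure_density) auto
  also have "\<dots> = ennreal (measure W UNIV)" by (rule ac_finite_emeasure[OF W])
  finally have m': "(\<integral>\<^sup>+y. g y \<partial>lebesgue) = ennreal (measure W UNIV)" .
  have "AE y in lebesgue. g y \<noteq> \<infinity>"
    using g(1) by (rule nn_integral_PInf_AE) (simp add: m')
  then have ae: "AE y in lebesgue. g y = ennreal \<bar>enn2real (g y)\<bar>"
    by eventually_elim (simp add: less_top)
  let ?f = "\<lambda>y. enn2real (g y)"
  have f: "?f \<in> borel_measurable lebesgue" using g(1) by measurable
  have "density lebesgue (\<lambda>y. ennreal \<bar>?f y\<bar>) = density lebesgue g"
    using ae f g(1) by (intro density_cong) (auto elim: eventually_mono)
  then have fW: "maxop_fun \<alpha> \<Omega> ?f = maxop \<alpha> \<Omega> W" by (simp add: maxop_fun_def g(2))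
  have fm: "(\<integral>\<^sup>+y. ennreal \<bar>?f y\<bar> \<partial>lebesgue) = ennreal (measure W UNIV)"
    unfolding m'[symmetric] using ae by (intro nn_integral_cong_AE) (auto elim: eventually_mono)
  \<comment> \<open>The zero measure is treated apart, since the supremum in
    \<open>maxop_norm\<close> ranges only over functions of positive mass.\<close>
  show ?thesis
  proof (cases "measure W UNIV = 0")
    case True
    have "maxop \<alpha> \<Omega> W x = 0" for x
    proof -
      have "emeasure W UNIV = 0" using ac_finite_emeasure[OF W, of UNIV] True by simp
      then have "AE y in W. False" by (intro AE_I[of _ _ UNIV]) (use W in \<open>auto simp: ac_finite_def\<close>)
      then have "(\<integral>\<^sup>+y\<in>ball x r. ennreal \<bar>\<Omega> (x - y)\<bar> \<partial>W) = (\<integral>\<^sup>+y. 0 \<partial>W)" for r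
        by (intro nn_integral_cong_AE) auto
      then show ?thesis by (simp add: maxop_def)
    qed
    then have eq: "maxop \<alpha> \<Omega> W = (\<lambda>x. 0)" by blast
    have "leb_outer ({} :: (real^'n) set) = 0" by (subst leb_outer_borel) auto
    then show ?thesis unfolding weak_norm_def eq by (intro SUP_least) (simp add: ennroot_def)
  next
    case False
    then have pos: "0 < measure W UNIV" using measure_nonneg[of W UNIV] by linarith
    have "?f \<in> {f. f \<in> borel_measurable lebesgue \<and> 0 < (\<integral>\<^sup>+y. ennreal \<bar>f y\<bar> \<partial>lebesgue) \<and>
        (\<integral>\<^sup>+y. ennreal \<bar>f y\<bar> \<partial>lebesgue) < \<infinity>}"
      unfolding mem_Collect_eq fm using f pos by simp
    then have "weak_norm ?p (maxop_fun \<alpha> \<Omega> ?f) / (\<integral>\<^sup>+y. ennreal \<bar>?f y\<bar> \<partial>lebesgue) \<le> maxop_norm \<alpha> \<Omega>"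
      unfolding maxop_norm_def by (rule SUP_upper)
    then have "weak_norm ?p (maxop \<alpha> \<Omega> W) / ennreal (measure W UNIV) \<le> maxop_norm \<alpha> \<Omega>" unfolding fm fW .
    then have "weak_norm ?p (maxop \<alpha> \<Omega> W) / ennreal (measure W UNIV) * ennreal (measure W UNIV)
      \<le> maxop_norm \<alpha> \<Omega> * ennreal (measure W UNIV)" by (rule mult_right_mono) simp
    also have "weak_norm ?p (maxop \<alpha> \<Omega> W) / ennreal (measure W UNIV) * ennreal (measure W UNIV) = weak_norm ?p (maxop \<alpha> \<Omega> W)"
      using pos by (simp add: ennreal_divide_times ennreal_times_divide mult_divide_eq_ennreal)
    also have "maxop_norm \<alpha> \<Omega> = ennreal (enn2real (maxop_norm \<alpha> \<Omega>))" using fin by simp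
    finally show ?thesis using pos by (simp add: ennreal_mult)
  qed
qed

section \<open>Measures concentrated near the origin\<close>

lemma measurable_pair_ac_finite:
  assumes W: "ac_finite W" and f: "(\<lambda>(x, y). f x y) \<in> borel_measurable (borel \<Otimes>\<^sub>M borel)"
  shows "(\<lambda>(x, y). f x y) \<in> borel_measurable (borel \<Otimes>\<^sub>M W)"
proof -
  have [measurable]: "(\<lambda>y. y) \<in> W \<rightarrow>\<^sub>M borel" by (rule ac_finite_measurable[OF W]) simp
  have "(\<lambda>z. (fst z, snd z)) \<in> borel \<Otimes>\<^sub>M W \<rightarrow>\<^sub>M borel \<Otimes>\<^sub>M borel" by measurable
  from measurable_compose[OF this f] show ?thesis by (simp add: case_prod_beta')
qed

context rough_kernel
begin

definition deviation :: "(real^'n) measure \<Rightarrow> real^'n \<Rightarrow> ennreal" where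
  "deviation W x = ennreal (1 / norm x powr a) * (\<integral>\<^sup>+y. ennreal \<bar>K (x - y) - K x\<bar> \<partial>W)"

lemma measurable_deviation:
  assumes W: "ac_finite W"
  shows "deviation W \<in> borel_measurable borel"
proof -
  interpret finite_measure W using W by (simp add: ac_finite_def)
  have "(\<lambda>(x, y). ennreal \<bar>K (x - y) - K x\<bar>) \<in> borel_measurable (borel \<Otimes>\<^sub>M W)"
    by (rule measurable_pair_ac_finite[OF W]) measurable
  from borel_measurable_nn_integral[OF this]
  have [measurable]: "(\<lambda>x. \<integral>\<^sup>+y. ennreal \<bar>K (x - y) - K x\<bar> \<partial>W) \<in> borel_measurable borel" .
  show ?thesis unfolding deviation_def[abs_def] by measurable
qed

text \<open>Tonelli moves the integral in x inside; \<open>translation_bound\<close> then applies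
  for W-almost every y, uniformly, because \<open>W\<close> lives on the ball of radius
  \<delta>.\<close>

lemma deviation_bound:
  assumes W: "ac_finite W" and conc: "AE y in W. norm y \<le> \<delta>" and \<delta>: "\<delta> < \<rho>"
  shows "(\<integral>\<^sup>+x. deviation W x * indicator {x. \<rho> \<le> norm x} x \<partial>lborel) \<le> ennreal (measure W UNIV) * Dini_rest \<rho> \<delta>"
proof -
  interpret W: finite_measure W using W by (simp add: ac_finite_def)
  interpret pair_sigma_finite "lborel :: (real^'n) measure" W ..
  let ?f = "\<lambda>x y. ennreal (\<bar>K (x - y) - K x\<bar> / norm x powr a) * indicator {x. \<rho> \<le> norm x} x"
  have f: "(\<lambda>(x, y). ?f x y) \<in> borel_measurable (borel \<Otimes>\<^sub>M W)"
    by (rule measurable_pair_ac_finite[OF W]) measurable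
  have f': "(\<lambda>(x, y). ?f x y) \<in> borel_measurable (lborel \<Otimes>\<^sub>M W)"
    using f by (subst measurable_cong_sets[OF sets_pair_measure_cong[OF sets_lborel refl] refl])
  have "(\<integral>\<^sup>+x. deviation W x * indicator {x. \<rho> \<le> norm x} x \<partial>lborel) = (\<integral>\<^sup>+x. (\<integral>\<^sup>+y. ?f x y \<partial>W) \<partial>lborel)"
  proof (rule nn_integral_cong)
    fix x :: "real^'n"
    have m: "(\<lambda>y. ennreal \<bar>K (x - y) - K x\<bar>) \<in> borel_measurable W"
      by (rule ac_finite_measurable[OF W]) measurable
    have "(\<integral>\<^sup>+y. ?f x y \<partial>W) = (\<integral>\<^sup>+y. (ennreal (1 / norm x powr a) * indicator {x. \<rho> \<le> norm x} x) * ennreal \<bar>K (x - y) - K x\<bar> \<partial>W)"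
      by (intro nn_integral_cong) (auto simp: ennreal_mult[symmetric] split: split_indicator)
    also have "\<dots> = (ennreal (1 / norm x powr a) * indicator {x. \<rho> \<le> norm x} x) * (\<integral>\<^sup>+y. ennreal \<bar>K (x - y) - K x\<bar> \<partial>W)"
      by (rule nn_integral_cmult[OF m])
    finally show "deviation W x * indicator {x. \<rho> \<le> norm x} x = (\<integral>\<^sup>+y. ?f x y \<partial>W)"
      by (simp add: deviation_def mult_ac)
  qed
  also have "\<dots> = (\<integral>\<^sup>+y. (\<integral>\<^sup>+x. ?f x y \<partial>lborel) \<partial>W)"
    using Fubini'[OF f'] by simp
  also have "\<dots> \<le> (\<integral>\<^sup>+y. Dini_rest \<rho> \<delta> \<partial>W)"
    using conc by (intro nn_integral_mono_AE) (auto elim!: eventually_mono intro: translation_bound[OF _ \<delta>])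
  also have "\<dots> = ennreal (measure W UNIV) * Dini_rest \<rho> \<delta>"
    by (simp add: ac_finite_space[OF W] ac_finite_emeasure[OF W] mult.commute)
  finally show ?thesis .
qed

text \<open>Markov's inequality applied to \<open>deviation_bound\<close>. The set is Borel because
  \<open>deviation\<close> is built from \<open>K\<close>, so its outer measure is its Lebesgue
  measure.\<close>

lemma deviation_weak_bound:
  assumes W: "ac_finite W" and conc: "AE y in W. norm y \<le> \<delta>" and \<delta>: "\<delta> < \<rho>" and c: "0 < c"
  shows "leb_outer {x. \<rho> \<le> norm x \<and> ennreal c \<le> deviation W x} \<le> ennreal (measure W UNIV / c) * Dini_rest \<rho> \<delta>"
proof -
  note [measurable] = measurable_deviation[OF W]
  let ?A = "{x::real^'n. \<rho> \<le> norm x}"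
  let ?S = "{x. \<rho> \<le> norm x \<and> ennreal c \<le> deviation W x}"
  have S: "?S = {x \<in> ?A. 1 \<le> ennreal (1 / c) * deviation W x}"
  proof -
    have "ennreal c \<le> t \<longleftrightarrow> 1 \<le> ennreal (1 / c) * t" for t
    proof
      assume "ennreal c \<le> t"
      then have "ennreal (1 / c) * ennreal c \<le> ennreal (1 / c) * t" by (rule mult_left_mono) simp
      then show "1 \<le> ennreal (1 / c) * t" using c by (simp add: ennreal_mult[symmetric])
    next
      assume "1 \<le> ennreal (1 / c) * t"
      then have "ennreal c * 1 \<le> ennreal c * (ennreal (1 / c) * t)" by (rule mult_left_mono) simp
      then show "ennreal c \<le> t" using c by (simp add: mult.assoc[symmetric] ennreal_mult[symmetric])
    qed
    then show ?thesis by auto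
  qed
  have "leb_outer ?S = emeasure lborel ?S" by (rule leb_outer_borel) measurable
  also have "\<dots> = emeasure lborel {x \<in> ?A. 1 \<le> ennreal (1 / c) * deviation W x}" by (simp only: S)
  also have "\<dots> \<le> ennreal (1 / c) * (\<integral>\<^sup>+x. deviation W x * indicator ?A x \<partial>lborel)"
  proof (rule nn_integral_Markov_inequality)
    show "(\<lambda>x. deviation W x * indicator ?A x) \<in> borel_measurable lborel" by measurable
    show "?A \<in> sets lborel" by measurable
  qed
  also have "\<dots> \<le> ennreal (1 / c) * (ennreal (measure W UNIV) * Dini_rest \<rho> \<delta>)"
    by (intro mult_left_mono deviation_bound[OF W conc \<delta>]) simp
  also have "\<dots> = ennreal (measure W UNIV / c) * Dini_rest \<rho> \<delta>"
    using c by (simp add: mult.assoc[symmetric] ennreal_mult[symmetric])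
  finally show ?thesis .
qed

text \<open>For fixed x the exceptional y form the reflected set x - Z, which is Lebesgue null and
  hence W-null. The equality therefore holds at every x, not only almost everywhere.\<close>

lemma maxop_eq_K:
  assumes W: "ac_finite W"
  shows "maxop \<alpha> \<Omega> W x = maxop \<alpha> K W x"
proof -
  have "AE y in W. \<Omega> (x - y) = K (x - y)"
    using ac_finite_AE[OF W null_sets_reflect[OF Z, of x]] by (auto elim: eventually_mono intro: \<Omega>_eq_K)
  then have "(\<integral>\<^sup>+y\<in>ball x r. ennreal \<bar>\<Omega> (x - y)\<bar> \<partial>W) = (\<integral>\<^sup>+y\<in>ball x r. ennreal \<bar>K (x - y)\<bar> \<partial>W)" for r
    by (intro nn_integral_cong_AE) (auto elim: eventually_mono)
  then show ?thesis by (simp add: maxop_def)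
qed

text \<open>All mass of \<open>W\<close> lies between distances |x| - \<delta> and |x| + \<delta>
  from x. Testing one radius slightly beyond |x| + \<delta> gives the lower bound; radii up to |x| -
  \<delta> see no mass, which gives the upper bound. Comparing r^a with |x|^a costs the factor
  \<kappa> = (1 + 2\<delta>/\<rho>)^a, and comparing K(x - y) with K(x) costs the deviation.\<close>

lemma
  assumes W: "ac_finite W" and conc: "AE y in W. norm y \<le> \<delta>"
    and \<delta>: "0 < \<delta>" "2 * \<delta> \<le> \<rho>" and x: "\<rho> \<le> norm x"
  shows maxop_lower: "ennreal (measure W UNIV * (\<bar>K x\<bar> / norm x powr a))
      \<le> ennreal ((1 + 2 * \<delta> / \<rho>) powr a) * maxop \<alpha> K W x + deviation W x"
    and maxop_upper: "maxop \<alpha> K W x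
      \<le> ennreal ((1 + 2 * \<delta> / \<rho>) powr a) * (ennreal (measure W UNIV * (\<bar>K x\<bar> / norm x powr a)) + deviation W x)"
proof -
  define \<kappa> where "\<kappa> = (1 + 2 * \<delta> / \<rho>) powr a"
  define c where "c = norm x powr a"
  define J where "J = (\<integral>\<^sup>+y. ennreal \<bar>K (x - y)\<bar> \<partial>W)"
  define D where "D = (\<integral>\<^sup>+y. ennreal \<bar>K (x - y) - K x\<bar> \<partial>W)"
  define m where "m = measure W UNIV"
  have \<rho>: "0 < \<rho>" and nx: "0 < norm x" using \<delta> x by linarith+
  have c: "0 < c" using nx by (simp add: c_def)
  have dev: "deviation W x = ennreal (1 / c) * D" by (simp add: deviation_def c_def D_def)
  have [measurable]: "(\<lambda>y. \<bar>K (x - y)\<bar>) \<in> borel_measurable W" "(\<lambda>y. \<bar>K (x - y) - K x\<bar>) \<in> borel_measurable W"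
    by (rule ac_finite_measurable[OF W]; measurable)+
  have const: "(\<integral>\<^sup>+y. ennreal \<bar>K x\<bar> \<partial>W) = ennreal (m * \<bar>K x\<bar>)"
    by (simp add: ac_finite_space[OF W] ac_finite_emeasure[OF W] m_def ennreal_mult mult.commute)
  have Jlow: "ennreal (m * \<bar>K x\<bar>) \<le> J + D"
    unfolding const[symmetric] J_def D_def
    using nn_integral_mono[of W "\<lambda>y. ennreal \<bar>K x\<bar>" "\<lambda>y. ennreal \<bar>K (x - y)\<bar> + ennreal \<bar>K (x - y) - K x\<bar>"]
    by (subst nn_integral_add[symmetric]) (auto simp: ennreal_plus[symmetric] simp del: ennreal_plus)
  have "J \<le> (\<integral>\<^sup>+y. ennreal \<bar>K x\<bar> + ennreal \<bar>K (x - y) - K x\<bar> \<partial>W)"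
    unfolding J_def by (intro nn_integral_mono) (auto simp: ennreal_plus[symmetric] simp del: ennreal_plus)
  also have "\<dots> = ennreal (m * \<bar>K x\<bar>) + D"
    unfolding D_def const[symmetric] by (rule nn_integral_add) auto
  finally have Jup: "J \<le> ennreal (m * \<bar>K x\<bar>) + D" .
  have split_c: "ennreal (1 / c) * (ennreal (m * \<bar>K x\<bar>) + D) = ennreal (m * (\<bar>K x\<bar> / c)) + deviation W x"
    unfolding dev distrib_left using c by (simp add: ennreal_mult[symmetric] m_def)
  have "0 < 1 + 2 * \<delta> / \<rho>" using \<delta> \<rho> by (intro add_pos_nonneg) auto
  then have \<kappa>: "0 < \<kappa>" by (simp add: \<kappa>_def)
  have nx\<delta>: "0 < norm x + 2 * \<delta>" using nx \<delta> by linarith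
  \<comment> \<open>As |x| \<ge> \<rho>, the increment 2\<delta> is at most |x| times
    2\<delta>/\<rho>.\<close>
  have "norm x + 2 * \<delta> \<le> norm x * (1 + 2 * \<delta> / \<rho>)"
    using x \<rho> \<delta> by (simp add: field_simps)
  then have "(norm x + 2 * \<delta>) powr a \<le> (norm x * (1 + 2 * \<delta> / \<rho>)) powr a"
    using a_pos \<delta> by (intro powr_mono2) auto
  also have "\<dots> = c * \<kappa>" using \<rho> \<delta> by (simp add: powr_mult c_def \<kappa>_def)
  finally have "1 / (c * \<kappa>) \<le> 1 / (norm x + 2 * \<delta>) powr a"
  proof (rule divide_left_mono)
    have "0 < (norm x + 2 * \<delta>) powr a" using nx\<delta> by simp
    then show "0 < c * \<kappa> * (norm x + 2 * \<delta>) powr a" using c \<kappa> by simp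
  qed simp
  then have lowc: "1 / c \<le> \<kappa> * (1 / (norm x + 2 * \<delta>) powr a)"
    using c \<kappa> by (simp add: field_simps)
  \<comment> \<open>The balls in \<open>maxop\<close> are open and mass may sit at |y| = \<delta>,
    so the radius has to exceed |x| + \<delta>; 2\<delta> leaves room.\<close>
  have ball: "(\<integral>\<^sup>+y\<in>ball x (norm x + 2 * \<delta>). ennreal \<bar>K (x - y)\<bar> \<partial>W) = J"
    unfolding J_def
  proof (rule nn_integral_cong_AE)
    show "AE y in W. ennreal \<bar>K (x - y)\<bar> * indicator (ball x (norm x + 2 * \<delta>)) y = ennreal \<bar>K (x - y)\<bar>"
      using conc
    proof eventually_elim
      case (elim y)
      have "dist x y \<le> norm x + norm y" by (simp add: dist_norm norm_triangle_ineq4)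
      then have "y \<in> ball x (norm x + 2 * \<delta>)" using elim \<delta> by simp
      then show ?case by simp
    qed
  qed
  have "ennreal (1 / (norm x + 2 * \<delta>) powr a) * J \<le> maxop \<alpha> K W x"
    unfolding maxop_def a_eq[symmetric] ball[symmetric]
    using nx\<delta> by (intro SUP_upper) (simp only: greaterThan_iff)
  then have M: "ennreal \<kappa> * (ennreal (1 / (norm x + 2 * \<delta>) powr a) * J) \<le> ennreal \<kappa> * maxop \<alpha> K W x"
    by (rule mult_left_mono) simp
  have "ennreal (m * (\<bar>K x\<bar> / c)) = ennreal (1 / c) * ennreal (m * \<bar>K x\<bar>)"
    using c by (simp add: ennreal_mult[symmetric] m_def)
  also have "\<dots> \<le> ennreal (1 / c) * (J + D)" by (rule mult_left_mono[OF Jlow]) simp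
  also have "\<dots> = ennreal (1 / c) * J + deviation W x" by (simp add: dev distrib_left)
  also have "ennreal (1 / c) * J \<le> ennreal (\<kappa> * (1 / (norm x + 2 * \<delta>) powr a)) * J"
    by (intro mult_right_mono ennreal_leI lowc) simp
  also have "\<dots> = ennreal \<kappa> * (ennreal (1 / (norm x + 2 * \<delta>) powr a) * J)"
    using \<kappa> by (subst ennreal_mult) (auto simp: mult.assoc)
  also note M
  finally show "ennreal (measure W UNIV * (\<bar>K x\<bar> / norm x powr a))
      \<le> ennreal ((1 + 2 * \<delta> / \<rho>) powr a) * maxop \<alpha> K W x + deviation W x"
    by (simp add: m_def c_def \<kappa>_def add_right_mono)
  \<comment> \<open>This is |x| \<le> (|x| - \<delta>)(1 + 2\<delta>/\<rho>) after expansion. It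
    amounts to |x| - \<delta> \<ge> \<rho>/2, which follows from |x| \<ge> \<rho> \<ge>
    2\<delta>.\<close>
  have "0 \<le> (2 * \<delta> / \<rho>) * (norm x - \<delta>) - \<delta>"
  proof -
    have "2 * \<rho> \<le> 2 * norm x" using x by simp
    then have "\<rho> \<le> 2 * (norm x - \<delta>)" unfolding right_diff_distrib using \<delta>(2) by linarith
    then have "(\<delta> / \<rho>) * \<rho> \<le> (\<delta> / \<rho>) * (2 * (norm x - \<delta>))" using \<delta> \<rho> by (intro mult_left_mono) auto
    then show ?thesis using \<rho> by (simp add: field_simps)
  qed
  then have "norm x \<le> (norm x - \<delta>) * (1 + 2 * \<delta> / \<rho>)" by (simp add: algebra_simps)
  then have "norm x powr a \<le> ((norm x - \<delta>) * (1 + 2 * \<delta> / \<rho>)) powr a"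
    using a_pos by (intro powr_mono2) auto
  also have "\<dots> = (norm x - \<delta>) powr a * \<kappa>" using x \<delta> \<rho> by (simp add: powr_mult \<kappa>_def)
  finally have up0: "c \<le> (norm x - \<delta>) powr a * \<kappa>" by (simp add: c_def)
  have nxd: "0 < norm x - \<delta>" using x \<delta> by linarith
  have upc: "1 / (norm x - \<delta>) powr a \<le> \<kappa> * (1 / c)"
    using up0 nxd c by (simp add: field_simps)
  show "maxop \<alpha> K W x
      \<le> ennreal ((1 + 2 * \<delta> / \<rho>) powr a) * (ennreal (measure W UNIV * (\<bar>K x\<bar> / norm x powr a)) + deviation W x)"
    unfolding maxop_def a_eq[symmetric]
  proof (rule SUP_least)
    fix r :: real assume "r \<in> {0<..}"
    then have r: "0 < r" by simp
    let ?I = "\<integral>\<^sup>+y\<in>ball x r. ennreal \<bar>K (x - y)\<bar> \<partial>W"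
    have "ennreal (1 / r powr a) * ?I \<le> ennreal (\<kappa> * (1 / c)) * J"
    proof (cases "r \<le> norm x - \<delta>")
      \<comment> \<open>The open ball about x of radius at most |x| - \<delta> is disjoint from the
        closed ball of radius \<delta> about the origin.\<close>
      case True
      have "?I = (\<integral>\<^sup>+y. 0 \<partial>W)"
      proof (rule nn_integral_cong_AE)
        show "AE y in W. ennreal \<bar>K (x - y)\<bar> * indicator (ball x r) y = 0"
          using conc
        proof eventually_elim
          case (elim y)
          have "norm x \<le> dist x y + norm y" using norm_triangle_sub[of x y] by (simp add: dist_norm add.commute)
          then have "y \<notin> ball x r" using elim True by simp
          then show ?case by simp
        qed
      qed
      then show ?thesis by simp
    next
      case False
      then have "(norm x - \<delta>) powr a \<le> r powr a" using nxd a_pos by (intro powr_mono2) auto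
      then have "1 / r powr a \<le> 1 / (norm x - \<delta>) powr a"
        using nxd r by (intro divide_left_mono) auto
      also note upc
      finally have "1 / r powr a \<le> \<kappa> * (1 / c)" .
      moreover have "?I \<le> J" unfolding J_def by (intro nn_integral_mono) (auto split: split_indicator)
      ultimately show ?thesis by (intro mult_mono ennreal_leI) auto
    qed
    also have "\<dots> = ennreal \<kappa> * (ennreal (1 / c) * J)"
      using \<kappa> c by (subst ennreal_mult) (auto simp: mult.assoc)
    also have "\<dots> \<le> ennreal \<kappa> * (ennreal (1 / c) * (ennreal (m * \<bar>K x\<bar>) + D))"
      by (intro mult_left_mono Jup) auto
    finally show "ennreal (1 / r powr a) * ?I
      \<le> ennreal ((1 + 2 * \<delta> / \<rho>) powr a) * (ennreal (measure W UNIV * (\<bar>K x\<bar> / norm x powr a)) + deviation W x)"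
      unfolding split_c by (simp add: \<kappa>_def m_def c_def)
  qed
qed

end

section \<open>Small balls, uniform and dilated measures, and a scalar estimate\<close>

lemma ex_small_ball:
  assumes "0 < e"
  shows "\<exists>\<rho>>0. emeasure lborel (ball (0::'a::euclidean_space) \<rho>) \<le> ennreal e"
proof -
  let ?U = "unit_ball_vol (real DIM('a))"
  \<comment> \<open>\<rho> \<le> 1 gives \<rho>^n \<le> \<rho>, after which the second bound makes
    the volume at most e.\<close>
  define \<rho> where "\<rho> = min 1 (e / (?U + 1))"
  have U: "0 < ?U" by simp
  have "0 < e / (?U + 1)" by (rule divide_pos_pos[OF assms add_pos_pos[OF U zero_less_one]])
  then have \<rho>: "0 < \<rho>" "\<rho> \<le> 1" by (auto simp: \<rho>_def)
  have "\<rho> ^ DIM('a) \<le> \<rho> ^ 1" using \<rho> by (intro power_decreasing) auto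
  then have "?U * \<rho> ^ DIM('a) \<le> (?U + 1) * (e / (?U + 1))"
    using U \<rho> by (intro mult_mono) (auto simp: \<rho>_def)
  also have "\<dots> = e" using add_pos_pos[OF U zero_less_one] by (metis less_irrefl nonzero_mult_div_cancel_left times_divide_eq_right)
  finally show ?thesis using \<rho> by (intro exI[of _ \<rho>]) (auto simp: emeasure_ball ennreal_leI)
qed

lemma ac_finite_uniform_ball:
  assumes "0 < \<delta>"
  defines "W \<equiv> uniform_measure lebesgue (ball (0::real^'n) \<delta>)"
  shows "ac_finite W" "measure W UNIV = 1" "AE y in W. norm y \<le> \<delta>"
proof -
  have b: "emeasure lebesgue (ball (0::real^'n) \<delta>) \<noteq> 0" "emeasure lebesgue (ball (0::real^'n) \<delta>) < \<infinity>"
    using assms less_imp_neq[OF unit_ball_vol_pos[of "real CARD('n)"]]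
    by (auto simp: emeasure_ball ennreal_mult_less_top)
  have 1: "emeasure W UNIV = 1"
    unfolding W_def using b by (subst emeasure_uniform_measure) (auto simp: less_top ennreal_divide_self)
  then show "measure W UNIV = 1" by (simp add: measure_def)
  have "finite_measure W" by (rule finite_measureI) (use 1 in \<open>simp add: W_def\<close>)
  moreover have "absolutely_continuous lebesgue W"
    unfolding W_def uniform_measure_def
    by (intro absolutely_continuousI_density measurable_completion borel_measurable_divide_ennreal
        borel_measurable_indicator borel_measurable_const) auto
  ultimately show "ac_finite W" by (simp add: ac_finite_def W_def)
  show "AE y in W. norm y \<le> \<delta>"
    unfolding W_def by (rule AE_uniform_measureI) auto
qed

text \<open>The dilated measure V(E/t) is the image of V under y \<mapsto> t y. Absolute continuity
  survives because the preimage of a null set is its dilate by 1/t.\<close>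

lemma ac_finite_distr_scale:
  fixes V :: "(real^'n) measure"
  assumes V: "ac_finite V" and t: "0 < t"
  shows "ac_finite (distr V lebesgue (\<lambda>y. t *\<^sub>R y))" (is "ac_finite ?W")
    and "A \<in> sets borel \<Longrightarrow> measure (distr V lebesgue (\<lambda>y. t *\<^sub>R y)) A = measure V {y. t *\<^sub>R y \<in> A}"
proof -
  have sV: "sets V = sets lebesgue" using V by (simp add: ac_finite_def)
  have m: "(\<lambda>y. t *\<^sub>R y) \<in> V \<rightarrow>\<^sub>M lebesgue"
    unfolding measurable_cong_sets[OF sV refl] by (rule lebesgue_measurable_scaling)
  have "finite_measure ?W"
    using V m by (intro finite_measure.finite_measure_distr) (auto simp: ac_finite_def)
  moreover have "B \<in> null_sets ?W" if B: "B \<in> null_sets lebesgue" for B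
  proof -
    have eq: "(\<lambda>y. t *\<^sub>R y) -` B = (\<lambda>y. (1 / t) *\<^sub>R y + 0) ` B"
    proof (intro set_eqI iffI)
      fix y assume "y \<in> (\<lambda>y. t *\<^sub>R y) -` B"
      then have "t *\<^sub>R y \<in> B" "y = (1 / t) *\<^sub>R (t *\<^sub>R y) + 0" using t by simp_all
      then show "y \<in> (\<lambda>y. (1 / t) *\<^sub>R y + 0) ` B" by (rule rev_image_eqI)
    next
      fix y assume "y \<in> (\<lambda>y. (1 / t) *\<^sub>R y + 0) ` B"
      then show "y \<in> (\<lambda>y. t *\<^sub>R y) -` B" using t by auto
    qed
    have "emeasure lebesgue ((\<lambda>y. t *\<^sub>R y) -` B) = ennreal (\<bar>1 / t\<bar> ^ DIM(real^'n)) * emeasure lebesgue B"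
      unfolding eq by (rule emeasure_lebesgue_affine)
    moreover have "(\<lambda>y. t *\<^sub>R y) -` B \<in> sets lebesgue"
      using measurable_sets[OF lebesgue_measurable_scaling, of B t] B by (auto simp: null_sets_def)
    ultimately have "(\<lambda>y. t *\<^sub>R y) -` B \<in> null_sets lebesgue" using B by (simp add: null_sets_def)
    then have "(\<lambda>y. t *\<^sub>R y) -` B \<in> null_sets V"
      using V by (auto simp: ac_finite_def absolutely_continuous_def)
    then show ?thesis using B m by (auto simp: null_sets_def emeasure_distr ac_finite_space[OF V])
  qed
  ultimately show "ac_finite ?W" by (auto simp: ac_finite_def absolutely_continuous_def)
  assume "A \<in> sets borel"
  then show "measure ?W A = measure V {y. t *\<^sub>R y \<in> A}"
    by (subst measure_distr[OF m]) (auto simp: ac_finite_space[OF V] vimage_def)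
qed

lemma measure_density_indicator:
  assumes W: "ac_finite W" and A: "A \<in> sets borel"
  shows "measure (density W (indicator A)) UNIV = measure W A"
proof -
  have "A \<in> sets W" using assms by (simp add: ac_finite_def)
  then have "emeasure (density W (indicator A)) UNIV = emeasure W A"
    by (subst emeasure_density) (auto simp: ac_finite_space[OF W, symmetric])
  then show ?thesis by (simp add: measure_def)
qed

text \<open>The arithmetic core of the concentration statement at one point x. Here m1, m2 are the
  masses near to and far from the origin, M1, M2, M the maximal functions of the two parts and of
  the whole, g the kernel size |\<Omega>(x)|/|x|^a, and h the deviation of the near part.\<close>

lemma two_sided_estimate:
  fixes l \<kappa> :: real
  assumes k: "1 \<le> \<kappa>" "\<kappa> \<le> 2" "2 * (\<kappa> - 1) * (m1 + m2) \<le> \<eta>"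
    and m: "0 \<le> m1" "0 \<le> m2" "m2 \<le> \<eta>" and g: "0 \<le> g" "8 * \<eta> * g \<le> l" and h: "0 \<le> h" "12 * h \<le> l"
    and M: "M1 \<le> M" "M \<le> M1 + M2" "4 * M2 \<le> l"
    and low: "m1 * g \<le> \<kappa> * M1 + h" and up: "M1 \<le> \<kappa> * (m1 * g + h)"
  shows "\<bar>M - g * (m1 + m2)\<bar> \<le> l"
proof -
  have mg: "0 \<le> m1 * g" "0 \<le> m2 * g" using m g by auto
  have m2g: "m2 * g \<le> \<eta> * g" using m g by (intro mult_right_mono) auto
  have "2 * (\<kappa> - 1) * (m1 + m2) * g \<le> \<eta> * g" using k(3) g by (intro mult_right_mono) auto
  then have kg: "2 * ((\<kappa> - 1) * (m1 * g)) + 2 * ((\<kappa> - 1) * (m2 * g)) \<le> \<eta> * g"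
    by (simp add: algebra_simps)
  have kg': "0 \<le> (\<kappa> - 1) * (m2 * g)" "0 \<le> (\<kappa> - 1) * (m1 * g)" using k mg by auto
  have kh: "\<kappa> * h \<le> 2 * h" "(\<kappa> - 1) * h \<le> h" using mult_right_mono[OF k(2) h(1)] by (auto simp: algebra_simps)
  have U: "M1 \<le> m1 * g + (\<kappa> - 1) * (m1 * g) + 2 * h"
    using up kh by (simp add: algebra_simps)
  \<comment> \<open>A crude bound, used only inside (\<kappa> - 1) M1, so that the error of the
    lower estimate is expressed by m1 g and h alone.\<close>
  have "M1 \<le> 2 * (m1 * g + h)"
    using up mult_right_mono[OF k(2), of "m1 * g + h"] mg h by linarith
  then have "(\<kappa> - 1) * M1 \<le> (\<kappa> - 1) * (2 * (m1 * g + h))" using k by (intro mult_left_mono) auto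
  then have "(\<kappa> - 1) * M1 \<le> 2 * ((\<kappa> - 1) * (m1 * g)) + 2 * ((\<kappa> - 1) * h)" by (simp add: algebra_simps)
  moreover have "m1 * g \<le> M1 + (\<kappa> - 1) * M1 + h" using low by (simp add: algebra_simps)
  ultimately have L: "m1 * g \<le> M1 + 2 * ((\<kappa> - 1) * (m1 * g)) + 2 * ((\<kappa> - 1) * h) + h" by linarith
  have e: "g * (m1 + m2) = m1 * g + m2 * g" by (simp add: algebra_simps)
  have gl: "8 * (\<eta> * g) \<le> l" using g by (simp add: mult.assoc)
  \<comment> \<open>Above, the excess is at most (\<kappa> - 1) m1 g + 2h + M2 \<le> l/16 + l/6 +
    l/4. Below, it is at most 2(\<kappa> - 1) m1 g + 3h + m2 g \<le> l/8 + l/4 + l/8.\<close>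
  have 1: "M - g * (m1 + m2) \<le> l" unfolding e using M U kg kg' gl h mg by linarith
  have 2: "g * (m1 + m2) - M \<le> l" unfolding e using M L kg kg' kh gl h mg m2g by linarith
  show ?thesis using 1 2 by linarith
qed

section \<open>Weak type bound for the kernel and its norm on the sphere\<close>

context rough_kernel
begin

lemma p_pos: "0 < p"
  using a_pos by (simp add: p_eq)

lemma maxop_weak_bound:
  assumes fin: "maxop_norm \<alpha> \<Omega> < \<infinity>" and W: "ac_finite W" and l: "0 < l"
  shows "leb_outer {x. ennreal l < maxop \<alpha> \<Omega> W x} \<le> ennreal ((enn2real (maxop_norm \<alpha> \<Omega>) * measure W UNIV / l) powr p)"
proof (rule weak_norm_leD[OF p_pos _ _ l])
  show "weak_norm p (maxop \<alpha> \<Omega> W) \<le> ennreal (enn2real (maxop_norm \<alpha> \<Omega>) * measure W UNIV)"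
    unfolding p_eq a_eq by (rule weak_norm_maxop_le[OF fin W])
qed simp

text \<open>\<rho> is fixed before \<delta>: both the distortion factor and the Dini tail tend to
  their limits for fixed \<rho>.\<close>

lemma eventually_small_parameter:
  assumes \<rho>: "0 < \<rho>" and e: "0 < e" and e': "0 < e'"
  shows "\<forall>\<^sub>F \<delta> in at_right 0. 0 < \<delta> \<and> 2 * \<delta> \<le> \<rho> \<and> (1 + 2 * \<delta> / \<rho>) powr a \<le> 1 + e \<and> Dini_rest \<rho> \<delta> \<le> ennreal e'"
proof (intro eventually_conj)
  show "\<forall>\<^sub>F \<delta> in at_right 0. (0::real) < \<delta>" by (simp add: eventually_at_right_less)
  have "((\<lambda>\<delta>. 2 * \<delta>) \<longlongrightarrow> 2 * 0) (at_right (0::real))" by (intro tendsto_intros)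
  then have "\<forall>\<^sub>F \<delta> in at_right 0. 2 * \<delta> < \<rho>" using order_tendstoD(2) \<rho> by fastforce
  then show "\<forall>\<^sub>F \<delta> in at_right 0. 2 * \<delta> \<le> \<rho>" by eventually_elim simp
  have "((\<lambda>\<delta>. (1 + 2 * \<delta> / \<rho>) powr a) \<longlongrightarrow> (1 + 2 * 0 / \<rho>) powr a) (at_right 0)"
    using \<rho> by (intro tendsto_intros) auto
  then have "\<forall>\<^sub>F \<delta> in at_right 0. (1 + 2 * \<delta> / \<rho>) powr a < 1 + e"
    using e by (intro order_tendstoD(2)) auto
  then show "\<forall>\<^sub>F \<delta> in at_right 0. (1 + 2 * \<delta> / \<rho>) powr a \<le> 1 + e" by eventually_elim simp
  have "\<forall>\<^sub>F \<delta> in at_right 0. Dini_rest \<rho> \<delta> < ennreal e'"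
    using e' by (intro order_tendstoD(2)[OF Dini_rest_tendsto[OF \<rho>]]) simp
  then show "\<forall>\<^sub>F \<delta> in at_right 0. Dini_rest \<rho> \<delta> \<le> ennreal e'" by eventually_elim simp
qed

lemma leb_outer_null_Un_ball:
  assumes "emeasure lborel (ball (0::real^'n) \<rho>) \<le> e"
  shows "leb_outer (Z \<union> ball 0 \<rho>) \<le> e"
proof -
  have "leb_outer (Z \<union> ball 0 \<rho>) \<le> leb_outer Z + leb_outer (ball (0::real^'n) \<rho>)" by (rule leb_outer_Un)
  also have "\<dots> = emeasure lborel (ball (0::real^'n) \<rho>)"
    using leb_outer_null[OF Z] leb_outer_borel[of "ball (0::real^'n) \<rho>"] by simp
  finally show ?thesis using assms by simp
qed

text \<open>Test with the uniform probability measure on a small ball, taking \<delta> so small that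
  \<kappa> \<le> 2. Off the null set and the \<rho>-ball, if maximal function and deviation are both
  at most l/4, then \<open>maxop_lower\<close> bounds the kernel by 2 l/4 + l/4 < l. The weak type
  bound at height l/4 yields the constant 4; everything else costs at most e.\<close>

lemma kernel_weak_bound:
  assumes fin: "maxop_norm \<alpha> \<Omega> < \<infinity>" and l: "0 < l"
  shows "leb_outer {x. ennreal l < ennreal \<bar>\<Omega> x / norm x powr a\<bar>} \<le> ennreal ((4 * enn2real (maxop_norm \<alpha> \<Omega>) / l) powr p)"
proof (rule ennreal_le_epsilon)
  let ?S = "{x. ennreal l < ennreal \<bar>\<Omega> x / norm x powr a\<bar>}"
  let ?N = "enn2real (maxop_norm \<alpha> \<Omega>)"
  fix e :: real assume e: "0 < e"
  obtain \<rho> where \<rho>: "0 < \<rho>" "emeasure lborel (ball (0::real^'n) \<rho>) \<le> ennreal (e / 2)"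
    using ex_small_ball[of "e / 2"] e by auto
  \<comment> \<open>A Dini tail of l e/8 becomes e/2 after Markov's inequality at height l/4 for a
    measure of mass 1.\<close>
  have "\<exists>\<delta>. 0 < \<delta> \<and> 2 * \<delta> \<le> \<rho> \<and> (1 + 2 * \<delta> / \<rho>) powr a \<le> 1 + 1 \<and> Dini_rest \<rho> \<delta> \<le> ennreal (l * e / 8)"
    using e l by (intro eventually_happens'[OF _ eventually_small_parameter[OF \<rho>(1)]]) auto
  then obtain \<delta> where \<delta>: "0 < \<delta>" "2 * \<delta> \<le> \<rho>" "(1 + 2 * \<delta> / \<rho>) powr a \<le> 2" "Dini_rest \<rho> \<delta> \<le> ennreal (l * e / 8)"
    by auto
  define W where "W = uniform_measure lebesgue (ball (0::real^'n) \<delta>)"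
  note W = ac_finite_uniform_ball[OF \<delta>(1), where 'n = 'n, folded W_def]
  let ?B = "{x. ennreal (l / 4) < maxop \<alpha> \<Omega> W x}"
  let ?C = "{x. \<rho> \<le> norm x \<and> ennreal (l / 4) \<le> deviation W x}"
  have sub: "?S \<subseteq> (Z \<union> ball 0 \<rho>) \<union> ?B \<union> ?C"
  proof
    fix x assume "x \<in> ?S"
    then have x: "l < \<bar>\<Omega> x / norm x powr a\<bar>" using l by (simp add: ennreal_less_iff)
    show "x \<in> (Z \<union> ball 0 \<rho>) \<union> ?B \<union> ?C"
    proof (rule ccontr)
      assume "\<not> ?thesis"
      then have n: "x \<notin> Z" "\<rho> \<le> norm x" "maxop \<alpha> \<Omega> W x \<le> ennreal (l / 4)" "deviation W x \<le> ennreal (l / 4)"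
        by auto
      have "ennreal (1 * (\<bar>K x\<bar> / norm x powr a)) \<le> ennreal ((1 + 2 * \<delta> / \<rho>) powr a) * maxop \<alpha> K W x + deviation W x"
        using maxop_lower[OF W(1,3) \<delta>(1,2) n(2)] W(2) by simp
      also have "\<dots> \<le> ennreal 2 * ennreal (l / 4) + ennreal (l / 4)"
        using n \<delta>(3) maxop_eq_K[OF W(1)] by (intro add_mono mult_mono ennreal_leI) auto
      also have "\<dots> = ennreal (2 * (l / 4) + l / 4)"
        using l by (simp add: ennreal_mult[symmetric] ennreal_plus[symmetric] del: ennreal_plus ennreal_numeral)
      finally have "\<bar>K x\<bar> / norm x powr a \<le> 2 * (l / 4) + l / 4" using l by simp
      then have "\<bar>K x\<bar> / norm x powr a \<le> l" using l by linarith
      then show False using x \<Omega>_eq_K[OF n(1)] by (simp add: abs_divide)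
    qed
  qed
  have B: "leb_outer ?B \<le> ennreal ((4 * ?N / l) powr p)"
  proof -
    have "?N * measure W UNIV / (l / 4) = 4 * ?N / l" by (simp add: W(2))
    then show ?thesis using maxop_weak_bound[OF fin W(1), of "l / 4"] l by (simp only: divide_pos_pos zero_less_numeral)
  qed
  have C: "leb_outer ?C \<le> ennreal (e / 2)"
  proof -
    have "leb_outer ?C \<le> ennreal (measure W UNIV / (l / 4)) * Dini_rest \<rho> \<delta>"
      using l \<delta> by (intro deviation_weak_bound[OF W(1,3)]) auto
    also have "\<dots> \<le> ennreal (measure W UNIV / (l / 4)) * ennreal (l * e / 8)"
      by (intro mult_left_mono \<delta>(4)) simp
    also have "\<dots> = ennreal (e / 2)" using W(2) l e by (simp add: ennreal_mult[symmetric])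
    finally show ?thesis .
  qed
  have "leb_outer ?S \<le> leb_outer (Z \<union> ball 0 \<rho>) + leb_outer ?B + leb_outer ?C"
    by (rule leb_outer_le_sum3[OF sub])
  also have "\<dots> \<le> ennreal (e / 2) + ennreal ((4 * ?N / l) powr p) + ennreal (e / 2)"
    by (intro add_mono B C leb_outer_null_Un_ball \<rho>(2))
  also have "\<dots> = ennreal ((4 * ?N / l) powr p) + ennreal e"
    using e by (simp add: ennreal_plus[symmetric] del: ennreal_plus)
  finally show "leb_outer ?S \<le> ennreal ((4 * ?N / l) powr p) + ennreal e" .
qed

lemma kernel_weak_norm:
  assumes fin: "maxop_norm \<alpha> \<Omega> < \<infinity>"
  shows "weak_norm p (\<lambda>x. ennreal \<bar>\<Omega> x / norm x powr a\<bar>) \<le> ennreal 4 * maxop_norm \<alpha> \<Omega>"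
proof -
  have "weak_norm p (\<lambda>x. ennreal \<bar>\<Omega> x / norm x powr a\<bar>) \<le> ennreal (4 * enn2real (maxop_norm \<alpha> \<Omega>))"
    using p_pos by (intro weak_norm_leI kernel_weak_bound[OF fin]) auto
  also have "\<dots> = ennreal 4 * maxop_norm \<alpha> \<Omega>" using fin by (simp add: ennreal_mult)
  finally show ?thesis .
qed

lemma kernel_weak_Lp:
  assumes fin: "maxop_norm \<alpha> \<Omega> < \<infinity>"
  shows "weak_Lp p (\<lambda>x. \<Omega> x / norm x powr a)"
proof -
  have "(\<lambda>x. K x / norm x powr a) \<in> borel_measurable lebesgue" by (rule measurable_completion) measurable
  moreover have "AE x in lborel. x \<notin> Z" by (rule AE_not_in[OF Z])
  then have "AE x in lborel. K x / norm x powr a = \<Omega> x / norm x powr a"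
    by eventually_elim (simp add: \<Omega>_eq_K)
  then have "AE x in lebesgue. K x / norm x powr a = \<Omega> x / norm x powr a" by (rule AE_completion)
  ultimately have "(\<lambda>x. \<Omega> x / norm x powr a) \<in> borel_measurable lebesgue" by (rule borel_measurable_AE)
  moreover have "weak_norm p (\<lambda>x. ennreal \<bar>\<Omega> x / norm x powr a\<bar>) < \<infinity>"
    by (rule le_less_trans[OF kernel_weak_norm[OF fin]]) (use fin in \<open>simp add: ennreal_mult_less_top\<close>)
  ultimately show ?thesis by (simp add: weak_Lp_def)
qed

text \<open>In the direction \<theta> the condition at \<theta>/u reads 1 < |K \<theta>| u^a, that
  is u > |K \<theta>|^(-1/a). The \<open>inv_radial\<close> mass of this half-line is |K
  \<theta>|^(n/a)/n, and p = n/a.\<close>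

lemma emeasure_superlevel_kernel:
  "ennreal (real CARD('n)) * emeasure lborel {x::real^'n. 1 < \<bar>K x / norm x powr a\<bar>} =
    (\<integral>\<^sup>+\<theta>. ennreal (\<bar>K \<theta>\<bar> powr p) \<partial>sphere_measure0)"
proof -
  interpret S: finite_measure "sphere_measure0 :: (real^'n) measure" by (rule finite_sphere_measure0)
  interpret R: sigma_finite_measure "inv_radial CARD('n)" by (rule sigma_finite_inv_radial)
  interpret P: pair_sigma_finite "inv_radial CARD('n)" "sphere_measure0 :: (real^'n) measure" ..
  let ?A = "{x::real^'n. 1 < \<bar>K x / norm x powr a\<bar>}"
  let ?F = "\<lambda>x. indicator ?A x :: ennreal"
  have A: "?A \<in> sets borel" by measurable
  then have F: "?F \<in> borel_measurable borel" by simp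
  have G: "(\<lambda>(u, \<theta>). ?F (\<theta> /\<^sub>R u)) \<in> borel_measurable (inv_radial CARD('n) \<Otimes>\<^sub>M (sphere_measure0 :: (real^'n) measure))"
    using measurable_sphere_dilation[OF F]
    by (subst measurable_cong_sets[OF sets_pair_measure_cong[OF sets_inv_radial refl] refl])
  have "emeasure lborel ?A = (\<integral>\<^sup>+x. ?F x \<partial>lborel)" using A by simp
  also have "\<dots> = (\<integral>\<^sup>+u. (\<integral>\<^sup>+\<theta>. ?F (\<theta> /\<^sub>R u) \<partial>sphere_measure0) \<partial>inv_radial CARD('n))"
    by (rule nn_integral_inv_polar[OF F])
  also have "\<dots> = (\<integral>\<^sup>+\<theta>. (\<integral>\<^sup>+u. ?F (\<theta> /\<^sub>R u) \<partial>inv_radial CARD('n)) \<partial>sphere_measure0)"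
    using P.Fubini'[OF G] by simp
  finally have 1: "emeasure lborel ?A = (\<integral>\<^sup>+\<theta>. (\<integral>\<^sup>+u. ?F (\<theta> /\<^sub>R u) \<partial>inv_radial CARD('n)) \<partial>sphere_measure0)" .
  have inner: "(\<integral>\<^sup>+u. ?F (\<theta> /\<^sub>R u) \<partial>inv_radial CARD('n)) = ennreal (1 / real CARD('n)) * ennreal (\<bar>K \<theta>\<bar> powr p)"
    if "\<theta> \<in> space sphere_measure0" for \<theta> :: "real^'n"
  proof -
    have \<theta>: "norm \<theta> = 1" using that by (simp add: space_sphere_measure0)
    define k where "k = \<bar>K \<theta>\<bar>"
    have F\<theta>: "AE u in inv_radial CARD('n). ?F (\<theta> /\<^sub>R u) = (if 0 < u \<and> 1 < k * u powr a then 1 else 0)"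
      using AE_inv_radial_pos
    proof eventually_elim
      case (elim u)
      have "\<theta> \<noteq> 0" using \<theta> by auto
      then have "K (\<theta> /\<^sub>R u) = K \<theta>" using K_hom elim by (simp add: homogeneous0_def)
      moreover have "norm (\<theta> /\<^sub>R u) powr a = 1 / u powr a"
        using \<theta> elim by (simp add: powr_divide divide_inverse[symmetric] inverse_eq_divide)
      ultimately show ?case using elim by (simp add: indicator_def k_def abs_mult)
    qed
    show ?thesis
    proof (cases "k = 0")
      \<comment> \<open>Where K vanishes no u satisfies the condition, whereas
        \<open>0 powr (- (1 / a))\<close> is 0 and would give the threshold s = 0; hence the
        separate case.\<close>
      case True
      have "(\<integral>\<^sup>+u. ?F (\<theta> /\<^sub>R u) \<partial>inv_radial CARD('n)) = (\<integral>\<^sup>+u. 0 \<partial>inv_radial CARD('n))"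
        using F\<theta> by (intro nn_integral_cong_AE) (auto simp: True elim: eventually_mono)
      then show ?thesis using True by (simp add: k_def)
    next
      case False
      then have k: "0 < k" by (simp add: k_def)
      define s where "s = k powr (- (1 / a))"
      have s: "0 < s" using k by (simp add: s_def)
      have iff: "1 < k * u powr a \<longleftrightarrow> s < u" if "0 < u" for u
      proof -
        have "s < u \<longleftrightarrow> s powr a < u powr a"
        proof
          show "s < u \<Longrightarrow> s powr a < u powr a" using s a_pos by (intro powr_less_mono2) auto
          show "s powr a < u powr a \<Longrightarrow> s < u" using that a_pos powr_mono2[of a u s] by (cases "s < u") auto
        qed
        also have "s powr a = 1 / k"
          unfolding s_def powr_powr using a_pos k by (simp add: powr_minus_divide)
        also have "1 / k < u powr a \<longleftrightarrow> 1 < k * u powr a" using k by (simp add: field_simps)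
        finally show ?thesis by simp
      qed
      have "(\<integral>\<^sup>+u. ?F (\<theta> /\<^sub>R u) \<partial>inv_radial CARD('n)) = (\<integral>\<^sup>+u. indicator {s<..} u \<partial>inv_radial CARD('n))"
      proof (rule nn_integral_cong_AE)
        show "AE u in inv_radial CARD('n). ?F (\<theta> /\<^sub>R u) = indicator {s<..} u"
          using F\<theta> AE_inv_radial_pos by eventually_elim (auto simp: iff indicator_def)
      qed
      also have "\<dots> = emeasure (inv_radial CARD('n)) {s<..}" by (rule nn_integral_indicator) simp
      also have "\<dots> = ennreal (1 / (real CARD('n) * s ^ CARD('n)))"
        using s by (intro emeasure_inv_radial_Ioi) auto
      also have "s ^ CARD('n) = k powr (- p)"
        using s by (simp add: powr_realpow[symmetric] s_def powr_powr p_eq)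
      also have "1 / (real CARD('n) * k powr (- p)) = 1 / real CARD('n) * k powr p"
        using k by (simp add: powr_minus_divide)
      finally show ?thesis by (simp add: ennreal_mult[symmetric] k_def)
    qed
  qed
  have Km: "(\<lambda>\<theta>. ennreal (\<bar>K \<theta>\<bar> powr p)) \<in> borel_measurable (sphere_measure0 :: (real^'n) measure)"
  proof -
    have "(\<lambda>\<theta>. \<theta>) \<in> (sphere_measure0 :: (real^'n) measure) \<rightarrow>\<^sub>M borel"
      unfolding measurable_cong_sets[OF sets_sphere_measure0 refl] by (rule measurable_restrict_space1) simp
    from measurable_compose[OF this, of "\<lambda>\<theta>. ennreal (\<bar>K \<theta>\<bar> powr p)" borel] show ?thesis by simp
  qed
  have "emeasure lborel ?A = (\<integral>\<^sup>+\<theta>. ennreal (1 / real CARD('n)) * ennreal (\<bar>K \<theta>\<bar> powr p) \<partial>sphere_measure0)"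
    unfolding 1 by (intro nn_integral_cong inner)
  also have "\<dots> = ennreal (1 / real CARD('n)) * (\<integral>\<^sup>+\<theta>. ennreal (\<bar>K \<theta>\<bar> powr p) \<partial>sphere_measure0)"
    by (rule nn_integral_cmult[OF Km])
  finally show ?thesis by (simp add: mult.assoc[symmetric] ennreal_mult[symmetric])
qed

text \<open>\<open>emeasure_superlevel_kernel\<close> expresses the p-th power integral on the
  sphere as n times a single superlevel measure, so \<open>kernel_weak_bound\<close> at height 1
  suffices. Taking p-th roots gives the constant 4 n^(1/p).\<close>

lemma sphere_Lp_bound:
  assumes fin: "maxop_norm \<alpha> \<Omega> < \<infinity>"
  shows "sphere_Lp p \<Omega>"
    and "ennreal (sphere_Lp_norm p \<Omega>) \<le> ennreal (4 * real CARD('n) powr (1 / p)) * maxop_norm \<alpha> \<Omega>"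
proof -
  let ?N = "enn2real (maxop_norm \<alpha> \<Omega>)"
  let ?I = "\<integral>\<^sup>+x. ennreal (\<bar>\<Omega> x\<bar> powr p) \<partial>sphere_measure"
  let ?A = "{x::real^'n. 1 < \<bar>K x / norm x powr a\<bar>}"
  let ?B = "{x. ennreal 1 < ennreal \<bar>\<Omega> x / norm x powr a\<bar>}"
  have "?I = (\<integral>\<^sup>+x. ennreal (\<bar>\<Omega> x\<bar> powr p) \<partial>sphere_measure0)"
    by (simp add: sphere_measure_eq nn_integral_completion)
  also have "\<dots> = (\<integral>\<^sup>+x. ennreal (\<bar>K x\<bar> powr p) \<partial>sphere_measure0)"
    using AE_sphere by (intro nn_integral_cong_AE) (auto elim: eventually_mono)
  also have "\<dots> = ennreal (real CARD('n)) * emeasure lborel ?A" by (rule emeasure_superlevel_kernel[symmetric])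
  also have "\<dots> \<le> ennreal (real CARD('n)) * ennreal ((4 * ?N / 1) powr p)"
  proof (rule mult_left_mono)
    have "emeasure lborel ?A = leb_outer ?A" by (rule leb_outer_borel[symmetric]) measurable
    also have "\<dots> \<le> leb_outer (Z \<union> ?B)" by (rule leb_outer_mono) (auto simp: \<Omega>_eq_K)
    also have "\<dots> \<le> leb_outer Z + leb_outer ?B" by (rule leb_outer_Un)
    also have "\<dots> = leb_outer ?B" using leb_outer_null[OF Z] by simp
    also have "\<dots> \<le> ennreal ((4 * ?N / 1) powr p)" by (rule kernel_weak_bound[OF fin]) simp
    finally show "emeasure lborel ?A \<le> ennreal ((4 * ?N / 1) powr p)" .
  qed simp
  also have "\<dots> = ennreal (real CARD('n) * (4 * ?N) powr p)" by (simp add: ennreal_mult)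
  finally have I: "?I \<le> ennreal (real CARD('n) * (4 * ?N) powr p)" .
  then have "?I < \<infinity>" by (auto intro: le_less_trans)
  then show "sphere_Lp p \<Omega>" using dini by (simp add: Dini_def sphere_Lp_def)
  have "enn2real ?I \<le> real CARD('n) * (4 * ?N) powr p" using I by (intro enn2real_leI) auto
  then have "sphere_Lp_norm p \<Omega> \<le> (real CARD('n) * (4 * ?N) powr p) powr (1 / p)"
    unfolding sphere_Lp_norm_def using p_pos by (intro powr_mono2) auto
  also have "\<dots> = 4 * real CARD('n) powr (1 / p) * ?N"
    using p_pos by (simp add: powr_mult powr_powr)
  finally have "ennreal (sphere_Lp_norm p \<Omega>) \<le> ennreal (4 * real CARD('n) powr (1 / p) * ?N)" by (rule ennreal_leI)
  also have "\<dots> = ennreal (4 * real CARD('n) powr (1 / p)) * maxop_norm \<alpha> \<Omega>"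
    using fin by (simp add: ennreal_mult)
  finally show "ennreal (sphere_Lp_norm p \<Omega>) \<le> ennreal (4 * real CARD('n) powr (1 / p)) * maxop_norm \<alpha> \<Omega>" .
qed

end

section \<open>Concentration of dilated measures\<close>

context rough_kernel
begin

text \<open>The maximal operator is subadditive and monotone in the measure. Working with
  \<open>K\<close> supplies the measurability needed to add the integrals.\<close>

lemma maxop_split:
  assumes W: "ac_finite W" and A: "A \<in> sets borel"
  shows "maxop \<alpha> K W x \<le> maxop \<alpha> K (density W (indicator A)) x + maxop \<alpha> K (density W (indicator (-A))) x" (is ?sum)
    and "maxop \<alpha> K (density W (indicator A)) x \<le> maxop \<alpha> K W x" (is ?mono)
proof -
  have AW[measurable]: "A \<in> sets W" "- A \<in> sets W" using assms by (simp_all add: ac_finite_def)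
  let ?f = "\<lambda>r y. ennreal \<bar>K (x - y)\<bar> * indicator (ball x r) y"
  have f: "?f r \<in> borel_measurable W" for r
  proof (rule ac_finite_measurable[OF W])
    have [measurable]: "ball x r \<in> sets borel" by simp
    show "?f r \<in> borel_measurable borel" by measurable
  qed
  note [measurable] = f
  have d: "(\<integral>\<^sup>+y. ?f r y \<partial>density W (indicator B)) = (\<integral>\<^sup>+y. indicator B y * ?f r y \<partial>W)"
    if "B \<in> sets W" for B r using that f by (intro nn_integral_density) auto
  have le: "ennreal (1 / r powr (real CARD('n) - \<alpha>)) * (\<integral>\<^sup>+y. ?f r y \<partial>L) \<le> maxop \<alpha> K L x" if "0 < r" for r L
    unfolding maxop_def using that by (intro SUP_upper) simp
  show ?sum
  proof (subst maxop_def, rule SUP_least)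
    fix r :: real assume "r \<in> {0<..}"
    then have r: "0 < r" by simp
    have "(\<integral>\<^sup>+y. ?f r y \<partial>W) = (\<integral>\<^sup>+y. indicator A y * ?f r y + indicator (-A) y * ?f r y \<partial>W)"
      by (intro nn_integral_cong) (auto split: split_indicator)
    also have "\<dots> = (\<integral>\<^sup>+y. ?f r y \<partial>density W (indicator A)) + (\<integral>\<^sup>+y. ?f r y \<partial>density W (indicator (-A)))"
      unfolding d[OF AW(1)] d[OF AW(2)] by (rule nn_integral_add) measurable
    finally have "ennreal (1 / r powr (real CARD('n) - \<alpha>)) * (\<integral>\<^sup>+y. ?f r y \<partial>W)
      = ennreal (1 / r powr (real CARD('n) - \<alpha>)) * (\<integral>\<^sup>+y. ?f r y \<partial>density W (indicator A))
      + ennreal (1 / r powr (real CARD('n) - \<alpha>)) * (\<integral>\<^sup>+y. ?f r y \<partial>density W (indicator (-A)))"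
      by (simp only: distrib_left)
    also have "\<dots> \<le> maxop \<alpha> K (density W (indicator A)) x + maxop \<alpha> K (density W (indicator (-A))) x"
      by (intro add_mono le r)
    finally show "ennreal (1 / r powr (real CARD('n) - \<alpha>)) * (\<integral>\<^sup>+y. ?f r y \<partial>W) \<le> \<dots>" .
  qed
  show ?mono
  proof (subst maxop_def, rule SUP_least)
    fix r :: real assume "r \<in> {0<..}"
    then have r: "0 < r" by simp
    have "(\<integral>\<^sup>+y. ?f r y \<partial>density W (indicator A)) \<le> (\<integral>\<^sup>+y. ?f r y \<partial>W)"
      unfolding d[OF AW(1)] by (intro nn_integral_mono) (auto split: split_indicator)
    then show "ennreal (1 / r powr (real CARD('n) - \<alpha>)) * (\<integral>\<^sup>+y. ?f r y \<partial>density W (indicator A)) \<le> maxop \<alpha> K W x"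
      by (intro order_trans[OF mult_left_mono le[OF r]]) auto
  qed
qed

text \<open>The near part, on the ball of radius \<delta>, is compared with the kernel by
  \<open>maxop_lower\<close> and \<open>maxop_upper\<close>; the far part has mass at most \<eta>
  and is absorbed by the weak type bound. The errors (\<kappa> - 1) times the kernel and far mass
  times the kernel are small only where the kernel is at most l/(8\<eta>), so the set where it is
  larger is removed by \<open>kernel_weak_bound\<close>.\<close>

lemma maxop_approximation:
  assumes fin: "maxop_norm \<alpha> \<Omega> < \<infinity>" and W: "ac_finite W"
    and \<delta>: "0 < \<delta>" "2 * \<delta> \<le> \<rho>" and \<kappa>: "(1 + 2 * \<delta> / \<rho>) powr a \<le> 1 + \<epsilon>" "\<epsilon> \<le> 1"
    and l: "0 < l" and \<eta>: "0 < \<eta>" "2 * \<epsilon> * measure W UNIV \<le> \<eta>" "measure W (- cball 0 \<delta>) \<le> \<eta>"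
  shows "leb_outer {x. \<bar>enn2ereal (maxop \<alpha> \<Omega> W x) - ereal (\<bar>\<Omega> x\<bar> / norm x powr a * measure W UNIV)\<bar> > ereal l}
    \<le> emeasure lborel (ball (0::real^'n) \<rho>)
      + ennreal ((32 * enn2real (maxop_norm \<alpha> \<Omega>) * \<eta> / l) powr p) * 2
      + ennreal (12 * measure W UNIV / l) * Dini_rest \<rho> \<delta>"
proof -
  let ?N = "enn2real (maxop_norm \<alpha> \<Omega>)"
  let ?C = "cball (0::real^'n) \<delta>"
  define W1 where "W1 = density W (indicator ?C)"
  define W2 where "W2 = density W (indicator (- ?C))"
  interpret finite_measure W using W by (simp add: ac_finite_def)
  have C: "?C \<in> sets borel" "- ?C \<in> sets borel" by auto
  have W1: "ac_finite W1" "measure W1 UNIV = measure W ?C"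
    unfolding W1_def by (rule ac_finite_density_indicator[OF W C(1)], rule measure_density_indicator[OF W C(1)])
  have W2: "ac_finite W2" "measure W2 UNIV = measure W (- ?C)"
    unfolding W2_def by (rule ac_finite_density_indicator[OF W C(2)], rule measure_density_indicator[OF W C(2)])
  have sC: "?C \<in> sets W" using W by (simp add: ac_finite_def)
  have conc: "AE y in W1. norm y \<le> \<delta>"
    unfolding W1_def using sC by (subst AE_density) (auto split: split_indicator)
  define m1 where "m1 = measure W ?C"
  define m2 where "m2 = measure W (- ?C)"
  have m: "0 \<le> m1" "0 \<le> m2" by (simp_all add: m1_def m2_def)
  have m12: "measure W UNIV = m1 + m2"
    using finite_measure_compl[OF sC] by (simp add: ac_finite_space[OF W] m1_def m2_def Compl_eq_Diff_UNIV)
  define g where "g x = \<bar>\<Omega> x / norm x powr a\<bar>" for x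
  let ?S = "{x. \<bar>enn2ereal (maxop \<alpha> \<Omega> W x) - ereal (\<bar>\<Omega> x\<bar> / norm x powr a * measure W UNIV)\<bar> > ereal l}"
  let ?S1 = "{x. ennreal (l / 4) < maxop \<alpha> \<Omega> W2 x}"
  let ?S2 = "{x. ennreal (l / (8 * \<eta>)) < ennreal (g x)}"
  let ?S3 = "{x. \<rho> \<le> norm x \<and> ennreal (l / 12) \<le> deviation W1 x}"
  have \<rho>: "0 < \<rho>" using \<delta> by linarith
  have sub: "?S \<subseteq> (Z \<union> ball 0 \<rho>) \<union> (?S1 \<union> ?S2) \<union> ?S3"
  proof
    fix x assume "x \<in> ?S"
    show "x \<in> (Z \<union> ball 0 \<rho>) \<union> (?S1 \<union> ?S2) \<union> ?S3"
    proof (rule ccontr)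
      assume "\<not> ?thesis"
      then have n: "x \<notin> Z" "\<rho> \<le> norm x" "maxop \<alpha> \<Omega> W2 x \<le> ennreal (l / 4)"
        "ennreal (g x) \<le> ennreal (l / (8 * \<eta>))" "deviation W1 x \<le> ennreal (l / 12)"
        by auto
      let ?\<kappa> = "(1 + 2 * \<delta> / \<rho>) powr a"
      have g: "\<bar>K x\<bar> / norm x powr a = g x" using \<Omega>_eq_K[OF n(1)] by (simp add: g_def abs_divide)
      have k1: "1 \<le> ?\<kappa>" using a_pos \<delta> \<rho> by (intro ge_one_powr_ge_zero) auto
      have low: "ennreal (m1 * g x) \<le> ennreal ?\<kappa> * maxop \<alpha> K W1 x + deviation W1 x"
        using maxop_lower[OF W1(1) conc \<delta> n(2)] unfolding W1(2) g m1_def .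
      have up: "maxop \<alpha> K W1 x \<le> ennreal ?\<kappa> * (ennreal (m1 * g x) + deviation W1 x)"
        using maxop_upper[OF W1(1) conc \<delta> n(2)] unfolding W1(2) g m1_def .
      \<comment> \<open>Off the exceptional sets every extended quantity is finite, so the estimate
        can be transferred to reals and finished by \<open>two_sided_estimate\<close>.\<close>
      obtain h where h: "0 \<le> h" "deviation W1 x = ennreal h" "h \<le> l / 12"
        using n(5) l by (cases "deviation W1 x") (auto simp: top_unique)
      obtain M2 where M2: "0 \<le> M2" "maxop \<alpha> K W2 x = ennreal M2" "M2 \<le> l / 4"
        using n(3) l unfolding maxop_eq_K[OF W2(1)] by (cases "maxop \<alpha> K W2 x") (auto simp: top_unique)
      have gx: "0 \<le> g x" by (simp add: g_def)
      have up': "maxop \<alpha> K W1 x \<le> ennreal (?\<kappa> * (m1 * g x + h))"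
      proof -
        have "ennreal ?\<kappa> * (ennreal (m1 * g x) + ennreal h) = ennreal (?\<kappa> * (m1 * g x + h))"
        proof -
          have "0 \<le> m1 * g x" using gx m by simp
          then show ?thesis using h(1) by (simp add: ennreal_plus[symmetric] ennreal_mult[symmetric] del: ennreal_plus)
        qed
        then show ?thesis using up unfolding h(2) by (simp only:)
      qed
      then obtain M1 where M1: "0 \<le> M1" "maxop \<alpha> K W1 x = ennreal M1" "M1 \<le> ?\<kappa> * (m1 * g x + h)"
        using gx m h k1 by (cases "maxop \<alpha> K W1 x") (auto simp: top_unique)
      have low': "m1 * g x \<le> ?\<kappa> * M1 + h"
        using low h(1) M1(1) unfolding h(2) M1(2)
        by (simp add: ennreal_mult[symmetric] ennreal_plus[symmetric] del: ennreal_plus)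
      have sum: "maxop \<alpha> K W x \<le> ennreal (M1 + M2)"
        using maxop_split(1)[OF W C(1), of x] M1(1) M2(1) unfolding W1_def[symmetric] W2_def[symmetric] M1(2) M2(2) by simp
      then obtain M where M: "0 \<le> M" "maxop \<alpha> K W x = ennreal M" "M \<le> M1 + M2"
        using M1(1) M2(1) by (cases "maxop \<alpha> K W x") (auto simp: top_unique simp del: ennreal_plus)
      have M1M: "M1 \<le> M"
        using maxop_split(2)[OF W C(1), of x] M(1) unfolding W1_def[symmetric] M1(2) M(2) by simp
      have "g x \<le> l / (8 * \<eta>)" using n(4) l \<eta> by simp
      then have gl: "8 * \<eta> * g x \<le> l" using \<eta> by (simp add: field_simps)
      have "2 * (?\<kappa> - 1) * (m1 + m2) \<le> 2 * \<epsilon> * (m1 + m2)"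
        using \<kappa> m by (intro mult_right_mono) auto
      then have kA: "2 * (?\<kappa> - 1) * (m1 + m2) \<le> \<eta>" using \<eta>(2) unfolding m12 by linarith
      have "\<bar>M - g x * (m1 + m2)\<bar> \<le> l"
        using \<kappa> h M2 \<eta>(3)
        by (intro two_sided_estimate[OF k1 _ kA m _ gx gl h(1) _ M1M M(3) _ low' M1(3)]) (auto simp: m2_def)
      moreover have "\<bar>enn2ereal (maxop \<alpha> \<Omega> W x) - ereal (\<bar>\<Omega> x\<bar> / norm x powr a * measure W UNIV)\<bar> = ereal \<bar>M - g x * (m1 + m2)\<bar>"
        unfolding maxop_eq_K[OF W] M(2) m12 using M(1) by (simp add: g_def abs_divide)
      ultimately show False using \<open>x \<in> ?S\<close> by simp
    qed
  qed
  have S1: "leb_outer ?S1 \<le> ennreal ((32 * ?N * \<eta> / l) powr p)"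
  proof -
    have "?N * measure W2 UNIV / (l / 4) \<le> 32 * ?N * \<eta> / l"
    proof -
      \<comment> \<open>The natural constant here is 4; it is enlarged to 32 to share one expression
        with the bound for \<open>?S2\<close>, where 4 N/(l/(8\<eta>)) = 32 N \<eta>/l.\<close>
      have "4 * (?N * measure W2 UNIV) \<le> 32 * (?N * \<eta>)"
        using \<eta> W2(2) by (intro mult_mono) auto
      then show ?thesis using l by (simp add: field_simps)
    qed
    then have "(?N * measure W2 UNIV / (l / 4)) powr p \<le> (32 * ?N * \<eta> / l) powr p"
      using p_pos l by (intro powr_mono2) auto
    then show ?thesis using maxop_weak_bound[OF fin W2(1), of "l / 4"] l
      by (meson divide_pos_pos ennreal_leI order_trans zero_less_numeral)
  qed
  have S2: "leb_outer ?S2 \<le> ennreal ((32 * ?N * \<eta> / l) powr p)"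
  proof -
    have "4 * ?N / (l / (8 * \<eta>)) = 32 * ?N * \<eta> / l" using \<eta> l by (simp add: field_simps)
    moreover have "0 < l / (8 * \<eta>)" using \<eta> l by simp
    ultimately show ?thesis using kernel_weak_bound[OF fin, of "l / (8 * \<eta>)"] unfolding g_def by (simp only:)
  qed
  have S3: "leb_outer ?S3 \<le> ennreal (12 * measure W UNIV / l) * Dini_rest \<rho> \<delta>"
  proof -
    have "leb_outer ?S3 \<le> ennreal (measure W1 UNIV / (l / 12)) * Dini_rest \<rho> \<delta>"
      using l \<delta> by (intro deviation_weak_bound[OF W1(1) conc]) auto
    also have "\<dots> \<le> ennreal (12 * measure W UNIV / l) * Dini_rest \<rho> \<delta>"
      using m l unfolding W1(2) m12 m1_def[symmetric] by (intro mult_right_mono ennreal_leI) (auto simp: field_simps)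
    finally show ?thesis .
  qed
  have "leb_outer (?S1 \<union> ?S2) \<le> leb_outer ?S1 + leb_outer ?S2" by (rule leb_outer_Un)
  also have "\<dots> \<le> ennreal ((32 * ?N * \<eta> / l) powr p) + ennreal ((32 * ?N * \<eta> / l) powr p)"
    by (intro add_mono S1 S2)
  finally have S12: "leb_outer (?S1 \<union> ?S2) \<le> ennreal ((32 * ?N * \<eta> / l) powr p) * 2" by (simp add: mult_2_right)
  show ?thesis
    by (rule order_trans[OF leb_outer_le_sum3[OF sub]]) (intro add_mono S12 S3 leb_outer_null_Un_ball order_refl)
qed

text \<open>Dilation by t carries the ball of radius R to that of radius t R without changing
  masses, so a single R makes the far mass at most \<eta> for all t. Then
  \<open>maxop_approximation\<close> with \<delta> = t R applies, and its four error contributions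
  are each made at most e/4 once t is small.\<close>

lemma maxop_concentration:
  assumes fin: "maxop_norm \<alpha> \<Omega> < \<infinity>" and V: "ac_finite V" and l: "0 < l"
  shows "((\<lambda>t. leb_outer {x. \<bar>enn2ereal (maxop \<alpha> \<Omega> (distr V lebesgue (\<lambda>y. t *\<^sub>R y)) x)
      - ereal (\<bar>\<Omega> x\<bar> / norm x powr a * measure V UNIV)\<bar> > ereal l}) \<longlongrightarrow> 0) (at_right 0)"
    (is "(?f \<longlongrightarrow> 0) _")
proof (rule order_tendstoI)
  let ?N = "enn2real (maxop_norm \<alpha> \<Omega>)"
  let ?A = "measure V UNIV"
  fix e0 :: ennreal assume "0 < e0"
  \<comment> \<open>The target e0 may be infinite; a finite positive real e below it takes
    over.\<close>
  then obtain e1 where e1: "0 < e1" "e1 < e0" using dense by blast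
  then have "e1 < top" by (metis less_top_ennreal top.not_eq_extremum order_less_trans)
  then obtain e where e: "0 < e" "ennreal e < e0" using e1 by (cases e1) auto
  have N: "0 \<le> ?N" and A: "0 \<le> ?A" by simp_all
  have frac: "x / (x + 1) \<le> 1" if "0 \<le> x" for x :: real using that by (simp add: divide_le_eq_1)
  \<comment> \<open>Chosen so that each of the two weak type terms is at most e/4. The summand 1 in
    \<open>?N + 1\<close> keeps the denominator positive when the norm is 0; \<open>?A + 1\<close>
    serves the same purpose below.\<close>
  define \<eta> where "\<eta> = l / (32 * (?N + 1)) * (e / 4) powr (1 / p)"
  have \<eta>: "0 < \<eta>" using l e N by (simp add: \<eta>_def add_nonneg_pos)
  have "32 * ?N * \<eta> / l = ?N / (?N + 1) * (e / 4) powr (1 / p)"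
  proof -
    have "32 * ?N * (l / (32 * q) * T) / l = ?N / q * T" if "0 < q" for q T :: real
      using that l by simp
    then show ?thesis unfolding \<eta>_def using add_nonneg_pos[OF N zero_less_one] by blast
  qed
  also have "\<dots> \<le> 1 * (e / 4) powr (1 / p)" by (intro mult_right_mono frac) (auto simp: N)
  finally have "(32 * ?N * \<eta> / l) powr p \<le> ((e / 4) powr (1 / p)) powr p"
    using p_pos l N \<eta> by (intro powr_mono2) auto
  also have "\<dots> = e / 4" using p_pos e by (simp add: powr_powr)
  finally have P: "(32 * ?N * \<eta> / l) powr p \<le> e / 4" .
  obtain \<rho> where \<rho>: "0 < \<rho>" "emeasure lborel (ball (0::real^'n) \<rho>) \<le> ennreal (e / 4)"
    using ex_small_ball[of "e / 4"] e by auto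
  interpret V: finite_measure V using V by (simp add: ac_finite_def)
  have "\<exists>R>0. measure V (- cball 0 R) \<le> \<eta>"
  proof -
    let ?B = "\<lambda>k::nat. - cball (0::real^'n) (real k)"
    have "(\<lambda>k. measure V (?B k)) \<longlonglongrightarrow> measure V (\<Inter>k. ?B k)"
    proof (rule V.finite_Lim_measure_decseq)
      show "range ?B \<subseteq> sets V"
      proof (intro image_subsetI)
        fix k :: nat
        have "?B k \<in> sets borel" by simp
        then show "?B k \<in> sets V" using V by (simp add: ac_finite_def)
      qed
      show "decseq ?B" unfolding decseq_def by (intro allI impI) (simp add: subset_ball cball_subset_cball_iff)
    qed
    moreover have "(\<Inter>k. ?B k) = {}"
    proof -
      have "\<exists>k. x \<notin> ?B k" for x :: "real^'n" using real_arch_simple[of "norm x"] by simp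
      then show ?thesis by blast
    qed
    ultimately have "(\<lambda>k. measure V (?B k)) \<longlonglongrightarrow> 0" by simp
    then have "eventually (\<lambda>k. measure V (?B k) < \<eta>) sequentially" using \<eta> by (rule order_tendstoD(2))
    moreover have "eventually (\<lambda>k. 0 < k) sequentially" by (rule eventually_gt_at_top)
    ultimately have "eventually (\<lambda>k. 0 < k \<and> measure V (?B k) < \<eta>) sequentially" by eventually_elim simp
    from eventually_happens'[OF sequentially_bot this] obtain k where "0 < k" "measure V (?B k) < \<eta>" by blast
    then show ?thesis by (intro exI[of _ "real k"]) auto
  qed
  then obtain R where R: "0 < R" "measure V (- cball 0 R) \<le> \<eta>" by blast
  define \<epsilon> where "\<epsilon> = min 1 (\<eta> / (2 * (?A + 1)))"
  have \<epsilon>: "0 < \<epsilon>" "\<epsilon> \<le> 1" using divide_pos_pos[OF \<eta> mult_pos_pos[OF zero_less_numeral add_nonneg_pos[OF A zero_less_one]]] by (auto simp: \<epsilon>_def)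
  have "2 * \<epsilon> * ?A \<le> 2 * (\<eta> / (2 * (?A + 1))) * ?A" using A by (intro mult_right_mono) (auto simp: \<epsilon>_def)
  also have "\<dots> = \<eta> * (?A / (?A + 1))"
  proof -
    have "2 * (\<eta> / (2 * q)) * ?A = \<eta> * (?A / q)" if "0 < q" for q :: real using that by simp
    then show ?thesis using add_nonneg_pos[OF A zero_less_one] by blast
  qed
  also have "\<dots> \<le> \<eta> * 1" using \<eta> by (intro mult_left_mono frac) (auto simp: A)
  finally have \<epsilon>A: "2 * \<epsilon> * ?A \<le> \<eta>" by simp
  \<comment> \<open>Makes the Markov term 12 A e'/l at most e/4.\<close>
  define e' where "e' = l * e / (48 * (?A + 1))"
  have e': "0 < e'" unfolding e'_def using l e A by (intro divide_pos_pos mult_pos_pos add_nonneg_pos) auto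
  have "12 * ?A / l * e' = e / 4 * (?A / (?A + 1))"
  proof -
    have "12 * ?A / l * (l * e / (48 * q)) = e / 4 * (?A / q)" if "0 < q" for q :: real
      using that l by simp
    then show ?thesis unfolding e'_def using add_nonneg_pos[OF A zero_less_one] by blast
  qed
  also have "\<dots> \<le> e / 4 * 1" using e by (intro mult_left_mono frac) (auto simp: A)
  finally have Ae': "12 * ?A / l * e' \<le> e / 4" by simp
  have "filterlim (\<lambda>t. t * R) (at_right 0) (at_right 0)"
    unfolding filterlim_at
  proof
    show "\<forall>\<^sub>F t in at_right 0. t * R \<in> {0<..} \<and> t * R \<noteq> 0"
      using eventually_at_right_less[of "0::real"] by eventually_elim (use R in simp)
    have "((\<lambda>t. t * R) \<longlongrightarrow> 0 * R) (at_right 0)" by (intro tendsto_intros)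
    then show "((\<lambda>t. t * R) \<longlongrightarrow> 0) (at_right 0)" by simp
  qed
  then have "\<forall>\<^sub>F t in at_right 0. 0 < t * R \<and> 2 * (t * R) \<le> \<rho> \<and> (1 + 2 * (t * R) / \<rho>) powr a \<le> 1 + \<epsilon> \<and> Dini_rest \<rho> (t * R) \<le> ennreal e'"
    using eventually_small_parameter[OF \<rho>(1) \<epsilon>(1) e'] unfolding filterlim_iff by blast
  then show "\<forall>\<^sub>F t in at_right 0. ?f t < e0"
    using eventually_at_right_less[of "0::real"]
  proof eventually_elim
    case (elim t)
    then have t: "0 < t" by simp
    let ?W = "distr V lebesgue (\<lambda>y. t *\<^sub>R y)"
    have W: "ac_finite ?W" by (rule ac_finite_distr_scale(1)[OF V t])
    have WA: "measure ?W UNIV = ?A" using ac_finite_distr_scale(2)[OF V t, of UNIV] by simp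
    have "{y. t *\<^sub>R y \<in> - cball 0 (t * R)} = - cball (0::real^'n) R" using t by (simp add: mult.commute[of t] set_eq_iff)
    then have WR: "measure ?W (- cball 0 (t * R)) \<le> \<eta>"
      using ac_finite_distr_scale(2)[OF V t, of "- cball 0 (t * R)"] R(2) by simp
    have "?f t \<le> emeasure lborel (ball (0::real^'n) \<rho>) + ennreal ((32 * ?N * \<eta> / l) powr p) * 2
      + ennreal (12 * ?A / l) * Dini_rest \<rho> (t * R)"
      using maxop_approximation[OF fin W, of "t * R" \<rho> \<epsilon> l \<eta>] elim \<epsilon> l \<eta> \<epsilon>A WR unfolding WA by blast
    also have "\<dots> \<le> ennreal (e / 4) + ennreal (e / 4) * 2 + ennreal (12 * ?A / l) * ennreal e'"
      using elim by (intro add_mono mult_mono \<rho>(2) ennreal_leI[OF P]) auto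
    also have "ennreal (12 * ?A / l) * ennreal e' \<le> ennreal (e / 4)"
      using Ae' A l e' by (simp add: ennreal_mult[symmetric] ennreal_leI)
    also have "ennreal (e / 4) + ennreal (e / 4) * 2 + ennreal (e / 4) = ennreal (e / 4 + e / 4 * 2 + e / 4)"
      using e by (simp add: mult_2_right ennreal_plus[symmetric] del: ennreal_plus)
    also have "\<dots> = ennreal e" by simp
    finally have "?f t \<le> ennreal e" by (simp add: add_left_mono)
    then show ?case using e(2) by (rule le_less_trans)
  qed
qed simp

end

section \<open>Assembly of the three conclusions\<close>

theorem theorem1p5:
  fixes \<alpha> :: real
  assumes "0 \<le> \<alpha>" and "\<alpha> < real CARD('n)"
  shows "\<exists>C>0. \<forall>\<Omega> :: real^'n \<Rightarrow> real.
    homogeneous0 \<Omega> \<and> Dini 1 \<alpha> \<Omega> \<and> maxop_norm \<alpha> \<Omega> < \<infinity> \<longrightarrow>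
      (weak_Lp (real CARD('n) / (real CARD('n) - \<alpha>)) (\<lambda>x. \<Omega> x / norm x powr (real CARD('n) - \<alpha>))
       \<and> weak_norm (real CARD('n) / (real CARD('n) - \<alpha>))
           (\<lambda>x. ennreal \<bar>\<Omega> x / norm x powr (real CARD('n) - \<alpha>)\<bar>)
         \<le> ennreal C * maxop_norm \<alpha> \<Omega>)
    \<and> (sphere_Lp (real CARD('n) / (real CARD('n) - \<alpha>)) \<Omega>
       \<and> ennreal (sphere_Lp_norm (real CARD('n) / (real CARD('n) - \<alpha>)) \<Omega>)
         \<le> ennreal C * maxop_norm \<alpha> \<Omega>)
    \<and> (\<forall>V :: (real^'n) measure. \<forall>l>0.
         sets V = sets lebesgue \<and> finite_measure V \<and> absolutely_continuous lebesgue V \<longrightarrow>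
         ((\<lambda>t. leb_outer {x. \<bar>enn2ereal (maxop \<alpha> \<Omega> (distr V lebesgue (\<lambda>y. t *\<^sub>R y)) x)
                 - ereal (\<bar>\<Omega> x\<bar> / norm x powr (real CARD('n) - \<alpha>) * measure V (space V))\<bar>
                 > ereal l})
          \<longlongrightarrow> 0) (at_right 0))"
proof -
  let ?a = "real CARD('n) - \<alpha>"
  let ?p = "real CARD('n) / ?a"
  \<comment> \<open>The sphere constant serves both norm bounds: n \<ge> 1 and 1/p \<ge> 0 make it
    at least 4, the constant of the weak kernel bound, and it depends only on n and
    \<alpha>.\<close>
  let ?C = "4 * real CARD('n) powr (1 / ?p)"
  have n: "1 \<le> real CARD('n)" by (simp add: Suc_le_eq)
  have "1 \<le> real CARD('n) powr (1 / ?p)" using n assms by (intro ge_one_powr_ge_zero) auto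
  then have C4: "4 \<le> ?C" by simp
  show ?thesis
  proof (intro exI[of _ ?C] conjI allI impI)
    show "0 < ?C" using C4 by linarith
    fix \<Omega> :: "real^'n \<Rightarrow> real"
    assume asm: "homogeneous0 \<Omega> \<and> Dini 1 \<alpha> \<Omega> \<and> maxop_norm \<alpha> \<Omega> < \<infinity>"
    then have fin: "maxop_norm \<alpha> \<Omega> < \<infinity>" and meas: "\<Omega> \<in> borel_measurable sphere_measure"
      by (auto simp: Dini_def sphere_Lp_def)
    obtain K Z where KZ: "K \<in> borel_measurable borel" "homogeneous0 K" "Z \<in> null_sets lborel"
      "\<And>x. x \<notin> Z \<Longrightarrow> \<Omega> x = K x" "AE \<theta> in sphere_measure0. \<Omega> \<theta> = K \<theta>"
      using homogeneous0_borel_version[OF conjunct1[OF asm] meas] by metis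
    interpret rough_kernel \<alpha> ?a ?p \<Omega> K Z
      by unfold_locales (use assms asm KZ in auto)
    show "weak_Lp ?p (\<lambda>x. \<Omega> x / norm x powr ?a)" by (rule kernel_weak_Lp[OF fin])
    have "weak_norm ?p (\<lambda>x. ennreal \<bar>\<Omega> x / norm x powr ?a\<bar>) \<le> ennreal 4 * maxop_norm \<alpha> \<Omega>"
      by (rule kernel_weak_norm[OF fin])
    also have "\<dots> \<le> ennreal ?C * maxop_norm \<alpha> \<Omega>" by (intro mult_right_mono ennreal_leI C4) simp
    finally show "weak_norm ?p (\<lambda>x. ennreal \<bar>\<Omega> x / norm x powr ?a\<bar>) \<le> ennreal ?C * maxop_norm \<alpha> \<Omega>" .
    show "sphere_Lp ?p \<Omega>" "ennreal (sphere_Lp_norm ?p \<Omega>) \<le> ennreal ?C * maxop_norm \<alpha> \<Omega>"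
      by (rule sphere_Lp_bound[OF fin])+
    fix V :: "(real^'n) measure" and l :: real
    assume "0 < l" "sets V = sets lebesgue \<and> finite_measure V \<and> absolutely_continuous lebesgue V"
    then have V: "ac_finite V" and l: "0 < l" by (simp_all add: ac_finite_def)
    show "((\<lambda>t. leb_outer {x. \<bar>enn2ereal (maxop \<alpha> \<Omega> (distr V lebesgue (\<lambda>y. t *\<^sub>R y)) x)
        - ereal (\<bar>\<Omega> x\<bar> / norm x powr ?a * measure V (space V))\<bar> > ereal l}) \<longlongrightarrow> 0) (at_right 0)"
      unfolding ac_finite_space[OF V] by (rule maxop_concentration[OF fin V l])
  qed
qed

end
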